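(* Let $F$ be a field and let $q,n,e\in\mathbb{N}$ with $q>1$ and $e\mid q^n-1$, and put $m=m(q,e)$. If $e\mid\Phi_d(q)$ for some $d\in\{6,9,10\}$ or for some $d$ that is a power of $2$, then $$\mathrm{LL}(A(q,n,e))=\left\lfloor n\frac{q-1}{m}\right\rfloor+1.$$
   Context: $\mathbb{N}$ denotes the set of positive integers, $\mathbb{N}_0=\mathbb{N}\cup\{0\}$. $\Phi_d(X)\in\mathbb{Q}[X]$ denotes the $d$-th cyclotomic polynomial. For $q,e\in\mathbb{N}$ with $\gcd(q,e)=1$, $m(q,e)$ is the smallest positive integer $t$ such that there exist $i_1,\dots,i_t\in\mathbb{N}_0$ (repetitions allowed) with $e\mid q^{i_1}+\dots+q^{i_t}$. For a field $F$ and $q,n,e\in\mathbb{N}$ with $q>1$ and $e\mid q^n-1$, let $I=(X_1^q,\dots,X_n^q)$ in the polynomial algebra $F[X_1,\dots,X_n]$ and $x_j=X_j+I$. Then $A(q,n,e)$ is the unital $F$-subalgebra of $F[x_1,\dots,x_n]=F[X_1,\dots,X_n]/I$ generated by all monomials $x_1^{i_1}\cdots x_n^{i_n}$ with $i_1+qi_2+\dots+q^{n-1}i_n\equiv 0\pmod e$. For a finite-dimensional algebra $A$ with Jacobson radical $\mathrm{J}(A)$, the Loewy length $\mathrm{LL}(A)$ is the smallest $l\in\mathbb{N}_0$ with $\mathrm{J}(A)^l=0$. *)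

theory Defs
  imports
    "HOL-Algebra.Algebra"
    "HOL-Library.Poly_Mapping"
    "HOL-Computational_Algebra.Polynomial"
begin

text \<open>
  Over \<open>\<complex>\<close> rather than \<open>\<rat>\<close>: the product of \<open>X - z\<close> over the primitive \<open>d\<close>-th roots of unity \<open>z\<close>.
  Its coefficients are integers.
\<close>

definition cyclotomic_poly :: "nat \<Rightarrow> complex poly" where
  "cyclotomic_poly d =
     (\<Prod>z | z ^ d = 1 \<and> (\<forall>k. 0 < k \<and> k < d \<longrightarrow> z ^ k \<noteq> 1). [:- z, 1:])"

definition min_power_sum_length :: "nat \<Rightarrow> nat \<Rightarrow> nat" where
  "min_power_sum_length q e =
     (LEAST t. 0 < t \<and> (\<exists>i :: nat \<Rightarrow> nat. e dvd (\<Sum>k<t. q ^ i k)))"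

text \<open>
  The polynomial ring over \<open>'a\<close> in the variables with indices \<open>0, \<dots>, n - 1\<close>. A monomial is a
  finitely supported exponent vector, a polynomial a finitely supported map from monomials to
  coefficients; multiplication in \<^typ>\<open>(nat \<Rightarrow>\<^sub>0 nat) \<Rightarrow>\<^sub>0 'a::comm_ring_1\<close> is convolution.
\<close>

definition mpoly_ring :: "nat \<Rightarrow> ((nat \<Rightarrow>\<^sub>0 nat) \<Rightarrow>\<^sub>0 'a::comm_ring_1) ring" where
  "mpoly_ring n =
     \<lparr>carrier = {p. \<forall>t\<in>Poly_Mapping.keys p. Poly_Mapping.keys t \<subseteq> {..<n}},
      monoid.mult = (*), one = 1, ring.zero = 0, add = (+)\<rparr>"

definition mpoly_const :: "'a \<Rightarrow> (nat \<Rightarrow>\<^sub>0 nat) \<Rightarrow>\<^sub>0 'a::comm_ring_1" where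
  "mpoly_const c = Poly_Mapping.single 0 c"

definition mpoly_monom :: "(nat \<Rightarrow>\<^sub>0 nat) \<Rightarrow> (nat \<Rightarrow>\<^sub>0 nat) \<Rightarrow>\<^sub>0 'a::comm_ring_1" where
  "mpoly_monom t = Poly_Mapping.single t 1"

definition mpoly_var :: "nat \<Rightarrow> (nat \<Rightarrow>\<^sub>0 nat) \<Rightarrow>\<^sub>0 'a::comm_ring_1" where
  "mpoly_var j = mpoly_monom (Poly_Mapping.single j 1)"

text \<open>
  \<^const>\<open>subalgebra\<close> does not require the unit to be contained; \<^const>\<open>subring\<close> does.
\<close>

definition generated_subalgebra ::
    "'r set \<Rightarrow> ('r, 'b) ring_scheme \<Rightarrow> 'r set \<Rightarrow> 'r set" where
  "generated_subalgebra K R S = \<Inter> {V. subring V R \<and> subalgebra K V R \<and> S \<subseteq> V}"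

definition power_ideal :: "nat \<Rightarrow> nat \<Rightarrow> ((nat \<Rightarrow>\<^sub>0 nat) \<Rightarrow>\<^sub>0 'a::comm_ring_1) set" where
  "power_ideal q n = Idl\<^bsub>mpoly_ring n\<^esub> {mpoly_var j ^ q | j. j < n}"

definition truncated_mpoly_ring ::
    "nat \<Rightarrow> nat \<Rightarrow> ((nat \<Rightarrow>\<^sub>0 nat) \<Rightarrow>\<^sub>0 'a::comm_ring_1) set ring" where
  "truncated_mpoly_ring q n = mpoly_ring n Quot power_ideal q n"

definition truncated_class ::
    "nat \<Rightarrow> nat \<Rightarrow> ((nat \<Rightarrow>\<^sub>0 nat) \<Rightarrow>\<^sub>0 'a::comm_ring_1) \<Rightarrow> ((nat \<Rightarrow>\<^sub>0 nat) \<Rightarrow>\<^sub>0 'a) set" where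
  "truncated_class q n p = power_ideal q n +>\<^bsub>mpoly_ring n\<^esub> p"

text \<open>
  The algebra \<open>A(q, n, e)\<close>. Variables are indexed from \<open>0\<close>, so the exponent of the variable with
  index \<open>j\<close> has weight \<open>q ^ j\<close>.
\<close>

definition algebra_A ::
    "'a::field itself \<Rightarrow> nat \<Rightarrow> nat \<Rightarrow> nat \<Rightarrow> ((nat \<Rightarrow>\<^sub>0 nat) \<Rightarrow>\<^sub>0 'a) set ring" where
  "algebra_A F q n e =
     (truncated_mpoly_ring q n)
       \<lparr>carrier :=
          generated_subalgebra
            (range (\<lambda>c. truncated_class q n (mpoly_const c)))
            (truncated_mpoly_ring q n)
            {truncated_class q n (mpoly_monom t) | t.
               Poly_Mapping.keys t \<subseteq> {..<n} \<and>
               e dvd (\<Sum>j<n. q ^ j * Poly_Mapping.lookup t j)}\<rparr>"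

text \<open>
  The intersection of all maximal ideals; this is the Jacobson radical for commutative rings only.
\<close>

definition jacobson_radical :: "('r, 'b) ring_scheme \<Rightarrow> 'r set" where
  "jacobson_radical R = carrier R \<inter> \<Inter> {M. maximalideal M R}"

text \<open>
  In the monoid \<^const>\<open>ideals_set\<close> the product is the ideal product and the unit the whole ring.
\<close>

definition loewy_length :: "('r, 'b) ring_scheme \<Rightarrow> nat" where
  "loewy_length R =
     (LEAST l::nat. jacobson_radical R [^]\<^bsub>ideals_set R\<^esub> l = {\<zero>\<^bsub>R\<^esub>})"

end

(*
  The algebra A(q, n, e) is spanned by the classes of the monomials x^t of weight
  t_1 + q t_2 + ... + q^(n-1) t_n divisible by e with all exponents below q; it is local, and its
  radical J is spanned by the nonconstant ones. The weight of x^t is a sum of deg(t) powers of q,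
  so a nonconstant x^t has degree at least m = m(q, e), and J^l lies in degrees >= l m. As all
  monomials of degree > n (q - 1) vanish, LL <= floor(n (q - 1) / m) + 1.

  For equality one needs n (q - 1) / m monomials in J with nonzero product. If e | q - 1, then
  m = e and the powers x_j^e do. Otherwise the hypothesis on the cyclotomic values gives m = 2
  (since q^h = -1 mod e for some h) or m = 3 and h = 3 (since q^6 + q^3 + 1 = 0 mod e), where in
  both cases h can be chosen such that e | 1 + q^h + ... + q^((m-1) h) and m h | n. The variables
  then split into blocks of the form {j, j + h, ..., j + (m-1) h}, and each block is used q - 1
  times.
*)
theory Submission
  imports
    Defs
    "HOL-Computational_Algebra.Fundamental_Theorem_Algebra"
    "HOL-Number_Theory.Cong"
begin

section \<open>Values of cyclotomic polynomials\<close>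

text \<open>A monic squarefree complex polynomial is the product of the linear factors of its roots,
  so it suffices to compare roots with the primitive \<open>d\<close>-th roots of unity.\<close>

lemma cyclotomic_poly_eqI:
  assumes "rsquarefree p" and "lead_coeff p = 1"
    and "\<And>z. poly p z = 0 \<longleftrightarrow> z ^ d = 1 \<and> (\<forall>k. 0 < k \<and> k < d \<longrightarrow> z ^ k \<noteq> 1)"
  shows "cyclotomic_poly d = p"
  using complex_poly_decompose_rsquarefree[OF assms(1)] assms(2,3)
  by (simp add: cyclotomic_poly_def)

lemma cyclotomic_poly_1: "cyclotomic_poly 1 = [:- 1, 1:]"
  by (rule cyclotomic_poly_eqI) (auto simp: rsquarefree_roots pderiv_pCons add_eq_0_iff)

lemma cyclotomic_poly_power_2:
  "cyclotomic_poly (2 ^ Suc a) = monom 1 (2 ^ a) + 1"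
proof (rule cyclotomic_poly_eqI)
  show "rsquarefree (monom 1 (2 ^ a) + 1 :: complex poly)"
    by (auto simp: rsquarefree_roots pderiv_add pderiv_monom poly_monom power_0_left)
  have "degree (1 :: complex poly) < degree (monom (1::complex) (2 ^ a))"
    by (simp add: degree_monom_eq)
  then show "lead_coeff (monom 1 (2 ^ a) + 1 :: complex poly) = 1"
    using lead_coeff_add_le[of "1 :: complex poly" "monom 1 (2 ^ a)"]
    by (simp add: add.commute degree_monom_eq)
next
  fix z :: complex
  have "z ^ 2 ^ a = - 1 \<longleftrightarrow> z ^ 2 ^ Suc a = 1 \<and> (\<forall>k. 0 < k \<and> k < 2 ^ Suc a \<longrightarrow> z ^ k \<noteq> 1)"
  proof
    assume neg: "z ^ 2 ^ a = - 1"
    have "z ^ k \<noteq> 1" if k: "0 < k" "k < 2 ^ Suc a" for k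
    proof
      assume one: "z ^ k = 1"
      \<comment> \<open>With \<open>k = 2 ^ b * r\<close> and \<open>r\<close> odd,
        \<open>k < 2 ^ Suc a\<close> forces \<open>b <= a\<close>, so \<open>2 ^ a * r\<close> is a
        multiple of \<open>k\<close>. Then \<open>z\<close> to this exponent is both
        \<open>(- 1) ^ r = - 1\<close> and 1.\<close>
      define b where "b = multiplicity 2 k"
      obtain r where r: "k = 2 ^ b * r" "odd r"
        using multiplicity_decompose'[of k 2] k(1) unfolding b_def by auto
      have "b \<le> a"
      proof (rule ccontr)
        assume "\<not> b \<le> a"
        then have "(2::nat) ^ Suc a \<le> 2 ^ b" by (intro power_increasing) auto
        with r k show False by (cases r) auto
      qed
      then have "2 ^ a * r = k * 2 ^ (a - b)"
        using r by (simp add: ac_simps flip: power_add)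
      then have "(z ^ 2 ^ a) ^ r = (z ^ k) ^ 2 ^ (a - b)"
        by (simp flip: power_mult)
      with neg one r show False by simp
    qed
    moreover have "z ^ 2 ^ Suc a = (z ^ 2 ^ a)\<^sup>2"
      by (simp add: mult.commute flip: power_mult)
    ultimately show "z ^ 2 ^ Suc a = 1 \<and> (\<forall>k. 0 < k \<and> k < 2 ^ Suc a \<longrightarrow> z ^ k \<noteq> 1)"
      using neg by simp
  next
    assume prim: "z ^ 2 ^ Suc a = 1 \<and> (\<forall>k. 0 < k \<and> k < 2 ^ Suc a \<longrightarrow> z ^ k \<noteq> 1)"
    then have "(z ^ 2 ^ a)\<^sup>2 = 1" by (simp flip: power_mult add: mult.commute)
    moreover have "z ^ 2 ^ a \<noteq> 1" using prim by simp
    ultimately show "z ^ 2 ^ a = - 1" by (simp add: power2_eq_1_iff)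
  qed
  then show "poly (monom 1 (2 ^ a) + 1) z = 0 \<longleftrightarrow>
      z ^ 2 ^ Suc a = 1 \<and> (\<forall>k. 0 < k \<and> k < 2 ^ Suc a \<longrightarrow> z ^ k \<noteq> 1)"
    by (simp add: poly_monom eq_neg_iff_add_eq_0)
qed

text \<open>Shortens the check of primitivity: each \<open>k\<close> with \<open>0 < k < d\<close>
  has a multiple congruent modulo \<open>d\<close> to a maximal proper divisor of \<open>d\<close>,
  so only these divisors have to be excluded as exponents.\<close>

lemma power_eq_1_trans:
  fixes z :: "'a::monoid_mult"
  assumes "z ^ d = 1" and "z ^ k = 1" and "[k * j = r] (mod d)"
  shows "z ^ r = 1"
proof -
  have red: "z ^ i = z ^ (i mod d)" for i
    using assms(1) by (metis mult_div_mod_eq power_add power_mult power_one mult_1)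
  have "z ^ r = z ^ (k * j)" using assms(3) red by (metis cong_def)
  then show ?thesis using assms(2) by (simp add: power_mult)
qed

lemma cyclotomic_poly_6: "cyclotomic_poly 6 = [:1, - 1, 1:]"
proof (rule cyclotomic_poly_eqI)
  show "rsquarefree [:1, - 1, 1 :: complex:]"
    unfolding rsquarefree_roots
  proof (intro allI notI, elim conjE)
    fix z :: complex assume "poly [:1, - 1, 1:] z = 0" "poly (pderiv [:1, - 1, 1:]) z = 0"
    then have "1 - z + z * z = 0" "z = 1 / 2"
      by (simp_all add: pderiv_pCons algebra_simps)
    then show False by simp
  qed
next
  fix z :: complex
  have fact: "z ^ 6 - 1 = (z ^ 3 - 1) * (z + 1) * (1 - z + z\<^sup>2)"
    by (simp add: algebra_simps eval_nat_numeral)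
  show "poly [:1, - 1, 1:] z = 0 \<longleftrightarrow> z ^ 6 = 1 \<and> (\<forall>k. 0 < k \<and> k < 6 \<longrightarrow> z ^ k \<noteq> 1)"
  proof
    assume "poly [:1, - 1, 1:] z = 0"
    then have root: "1 - z + z\<^sup>2 = 0" by (simp add: algebra_simps power2_eq_square)
    then have six: "z ^ 6 = 1" using fact by simp
    have three: "z ^ 3 \<noteq> 1"
    proof
      assume "z ^ 3 = 1"
      \<comment> \<open>A Bezout identity: a common root of the two polynomials would make a nonzero
        constant vanish. The numerical identities that follow, also for the indices 9 and 10, serve
        the same purpose.\<close>
      moreover have "2 = (z + 1) * (1 - z + z\<^sup>2) - (z ^ 3 - 1)"
        by (simp add: algebra_simps eval_nat_numeral)
      ultimately show False using root by simp
    qed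
    have two: "z ^ 2 \<noteq> 1"
    proof
      assume "z ^ 2 = 1"
      moreover have "3 = (2 + z) * ((1 - z + z\<^sup>2) - (z\<^sup>2 - 1)) + (z\<^sup>2 - 1)"
        by (simp add: algebra_simps eval_nat_numeral)
      ultimately show False using root by simp
    qed
    have "z ^ k \<noteq> 1" if k: "0 < k" "k < 6" for k
    proof
      assume "z ^ k = 1"
      moreover have "[k * 3 = 3] (mod 6) \<or> [k * 1 = 2] (mod 6) \<or> [k * 2 = 2] (mod 6)"
      proof -
        have "k \<in> {1, 2, 3, 4, 5}" using k by auto
        then show ?thesis by (auto simp: cong_def)
      qed
      ultimately show False using power_eq_1_trans[OF six] two three by blast
    qed
    with six show "z ^ 6 = 1 \<and> (\<forall>k. 0 < k \<and> k < 6 \<longrightarrow> z ^ k \<noteq> 1)" by blast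
  next
    assume prim: "z ^ 6 = 1 \<and> (\<forall>k. 0 < k \<and> k < 6 \<longrightarrow> z ^ k \<noteq> 1)"
    then have "z ^ 3 \<noteq> 1" "z\<^sup>2 \<noteq> 1" by simp_all
    moreover from this have "z + 1 \<noteq> 0" by (auto simp: add_eq_0_iff2)
    ultimately have "1 - z + z\<^sup>2 = 0" using fact prim by simp
    then show "poly [:1, - 1, 1:] z = 0" by (simp add: algebra_simps power2_eq_square)
  qed
qed simp

lemma cyclotomic_poly_9: "cyclotomic_poly 9 = [:1, 0, 0, 1, 0, 0, 1:]"
proof (rule cyclotomic_poly_eqI)
  have poly: "poly [:1, 0, 0, 1, 0, 0, 1:] z = 1 + z ^ 3 + z ^ 6" for z :: complex
    by (simp add: algebra_simps eval_nat_numeral)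
  show "rsquarefree [:1, 0, 0, 1, 0, 0, 1 :: complex:]"
    unfolding rsquarefree_roots
  proof (intro allI notI, elim conjE)
    fix z :: complex
    assume root: "poly [:1, 0, 0, 1, 0, 0, 1:] z = 0"
      and "poly (pderiv [:1, 0, 0, 1, 0, 0, 1:]) z = 0"
    moreover have "poly (pderiv [:1, 0, 0, 1, 0, 0, 1:]) z = 3 * z ^ 2 * (1 + 2 * z ^ 3)"
      by (simp add: pderiv_pCons algebra_simps eval_nat_numeral)
    ultimately have "z = 0 \<or> 1 + 2 * z ^ 3 = 0" by simp
    then show False
    proof
      assume "1 + 2 * z ^ 3 = 0"
      \<comment> \<open>Completing the square in \<open>w = z ^ 3\<close>: the discriminant of
        \<open>1 + w + w^2\<close> is -3.\<close>
      moreover have "3 = 4 * (1 + z ^ 3 + z ^ 6) - (1 + 2 * z ^ 3) * (1 + 2 * z ^ 3)"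
        by (simp add: algebra_simps eval_nat_numeral)
      ultimately show False using root[unfolded poly] by simp
    qed (use root in simp)
  qed
  fix z :: complex
  have fact: "z ^ 9 - 1 = (z ^ 3 - 1) * (1 + z ^ 3 + z ^ 6)"
    by (simp add: algebra_simps eval_nat_numeral)
  show "poly [:1, 0, 0, 1, 0, 0, 1:] z = 0 \<longleftrightarrow>
      z ^ 9 = 1 \<and> (\<forall>k. 0 < k \<and> k < 9 \<longrightarrow> z ^ k \<noteq> 1)"
    unfolding poly
  proof
    assume root: "1 + z ^ 3 + z ^ 6 = 0"
    then have nine: "z ^ 9 = 1" using fact by simp
    have three: "z ^ 3 \<noteq> 1"
    proof
      assume "z ^ 3 = 1"
      moreover have "3 = (1 + z ^ 3 + z ^ 6) - (z ^ 3 - 1) * (z ^ 3 + 2)"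
        by (simp add: algebra_simps eval_nat_numeral)
      ultimately show False using root by simp
    qed
    have "z ^ k \<noteq> 1" if k: "0 < k" "k < 9" for k
    proof
      assume "z ^ k = 1"
      moreover have "\<exists>j\<in>{1, 2, 3, 6}. [k * j = 3] (mod 9)"
      proof -
        have "k \<in> {1, 2, 3, 4, 5, 6, 7, 8}" using k by auto
        then show ?thesis by (auto simp: cong_def)
      qed
      ultimately show False using power_eq_1_trans[OF nine] three by blast
    qed
    with nine show "z ^ 9 = 1 \<and> (\<forall>k. 0 < k \<and> k < 9 \<longrightarrow> z ^ k \<noteq> 1)" by blast
  next
    assume "z ^ 9 = 1 \<and> (\<forall>k. 0 < k \<and> k < 9 \<longrightarrow> z ^ k \<noteq> 1)"
    then have "z ^ 9 = 1" "z ^ 3 \<noteq> 1" by simp_all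
    then show "1 + z ^ 3 + z ^ 6 = 0" using fact by simp
  qed
qed simp

lemma cyclotomic_poly_10: "cyclotomic_poly 10 = [:1, - 1, 1, - 1, 1:]"
proof (rule cyclotomic_poly_eqI)
  have poly: "poly [:1, - 1, 1, - 1, 1:] z = 1 - z + z ^ 2 - z ^ 3 + z ^ 4" for z :: complex
    by (simp add: algebra_simps eval_nat_numeral)
  show "rsquarefree [:1, - 1, 1, - 1, 1 :: complex:]"
    unfolding rsquarefree_roots
  proof (intro allI notI, elim conjE)
    fix z :: complex
    assume root: "poly [:1, - 1, 1, - 1, 1:] z = 0"
      and deriv: "poly (pderiv [:1, - 1, 1, - 1, 1:]) z = 0"
    \<comment> \<open>This is the derivative of \<open>(z + 1) * f = z ^ 5 + 1\<close>, where
      \<open>f\<close> is the polynomial in question.\<close>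
    have "5 * z ^ 4 = poly [:1, - 1, 1, - 1, 1:] z + (z + 1) * poly (pderiv [:1, - 1, 1, - 1, 1:]) z"
      by (simp add: pderiv_pCons algebra_simps eval_nat_numeral)
    with root deriv have "z = 0" by simp
    with root show False by simp
  qed
  fix z :: complex
  have fact: "z ^ 10 - 1 = (z ^ 5 - 1) * (z + 1) * (1 - z + z ^ 2 - z ^ 3 + z ^ 4)"
    by (simp add: algebra_simps eval_nat_numeral)
  show "poly [:1, - 1, 1, - 1, 1:] z = 0 \<longleftrightarrow>
      z ^ 10 = 1 \<and> (\<forall>k. 0 < k \<and> k < 10 \<longrightarrow> z ^ k \<noteq> 1)"
    unfolding poly
  proof
    assume root: "1 - z + z ^ 2 - z ^ 3 + z ^ 4 = 0"
    then have ten: "z ^ 10 = 1" using fact by simp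
    have five: "z ^ 5 \<noteq> 1"
    proof
      assume "z ^ 5 = 1"
      moreover have "2 = (z + 1) * (1 - z + z ^ 2 - z ^ 3 + z ^ 4) - (z ^ 5 - 1)"
        by (simp add: algebra_simps eval_nat_numeral)
      ultimately show False using root by simp
    qed
    have two: "z ^ 2 \<noteq> 1"
    proof
      assume "z ^ 2 = 1"
      \<comment> \<open>Division by \<open>z ^ 2 - 1\<close> leaves the remainder
        \<open>3 - 2 * z\<close>, and
        \<open>(3 + 2 * z) * (3 - 2 * z) = 9 - 4 * z ^ 2\<close>.\<close>
      moreover have "5 = (3 + 2 * z) * ((1 - z + z ^ 2 - z ^ 3 + z ^ 4) - (z ^ 2 - 1) * (z ^ 2 - z + 2))
          + 4 * (z ^ 2 - 1)"
        by (simp add: algebra_simps eval_nat_numeral)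
      ultimately show False using root by simp
    qed
    have "z ^ k \<noteq> 1" if k: "0 < k" "k < 10" for k
    proof
      assume "z ^ k = 1"
      moreover have "[k * 5 = 5] (mod 10) \<or> (\<exists>j\<in>{1, 2, 3, 4}. [k * j = 2] (mod 10))"
      proof -
        have "k \<in> {1, 2, 3, 4, 5, 6, 7, 8, 9}" using k by auto
        then show ?thesis by (auto simp: cong_def)
      qed
      ultimately show False using power_eq_1_trans[OF ten] two five by blast
    qed
    with ten show "z ^ 10 = 1 \<and> (\<forall>k. 0 < k \<and> k < 10 \<longrightarrow> z ^ k \<noteq> 1)" by blast
  next
    assume prim: "z ^ 10 = 1 \<and> (\<forall>k. 0 < k \<and> k < 10 \<longrightarrow> z ^ k \<noteq> 1)"
    then have "z ^ 5 \<noteq> 1" "z\<^sup>2 \<noteq> 1" by simp_all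
    moreover from this have "z + 1 \<noteq> 0" by (auto simp: add_eq_0_iff2)
    ultimately show "1 - z + z ^ 2 - z ^ 3 + z ^ 4 = 0" using fact prim by simp
  qed
qed simp

text \<open>Carries divisibility from complex values back to natural numbers by injectivity of
  \<open>of_int\<close>. The cofactor \<open>b\<close> allows the value to be replaced by a simpler
  multiple.\<close>

lemma cyclotomic_value_dvd:
  fixes q e d :: nat and k :: int
  assumes "poly (cyclotomic_poly d) (of_nat q) = of_int (int e * k)"
    and "poly (cyclotomic_poly d) (of_nat q) * of_nat b = of_nat c"
  shows "e dvd c"
proof -
  have "(of_int (int e * k * int b) :: complex) = of_int (int c)"
    using assms by simp
  then have "int e * k * int b = int c" unfolding of_int_eq_iff .
  then have "int e dvd int c" by (metis dvd_triv_left mult.assoc)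
  then show ?thesis by simp
qed

text \<open>Multiplication by \<open>q + 1\<close> turns the values at the indices 6 and 10 into
  \<open>q ^ 3 + 1\<close> and \<open>q ^ 5 + 1\<close>. The value at \<open>2 ^ Suc a\<close> is
  already \<open>q ^ 2 ^ a + 1\<close>. The indices 1 and 9 yield the two other
  alternatives.\<close>

lemma dvd_cyclotomic_value_cases:
  fixes q e d :: nat and k :: int
  assumes "d \<in> {6, 9, 10} \<or> (\<exists>a. d = 2 ^ a)" and "0 < q"
    and k: "poly (cyclotomic_poly d) (of_nat q) = of_int (int e * k)"
  shows "e dvd q - 1 \<or> (\<exists>h. e dvd q ^ h + 1) \<or> e dvd q ^ 6 + q ^ 3 + 1"
proof -
  consider "d = 6" | "d = 9" | "d = 10" | "d = 1" | a where "d = 2 ^ Suc a"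
    using assms(1) by (metis insert_iff empty_iff old.nat.exhaust power_0)
  then show ?thesis
  proof cases
    case 1
    then have "e dvd q ^ 3 + 1"
      by (intro cyclotomic_value_dvd[OF k, of "q + 1"], unfold 1 cyclotomic_poly_6)
        (simp add: algebra_simps eval_nat_numeral)
    then show ?thesis by blast
  next
    case 2
    then have "e dvd q ^ 6 + q ^ 3 + 1"
      by (intro cyclotomic_value_dvd[OF k, of 1], unfold 2 cyclotomic_poly_9)
        (simp add: algebra_simps eval_nat_numeral)
    then show ?thesis by blast
  next
    case 3
    then have "e dvd q ^ 5 + 1"
      by (intro cyclotomic_value_dvd[OF k, of "q + 1"], unfold 3 cyclotomic_poly_10)
        (simp add: algebra_simps eval_nat_numeral)
    then show ?thesis by blast
  next
    case 4
    then have "e dvd q - 1"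
      using \<open>0 < q\<close>
      by (intro cyclotomic_value_dvd[OF k, of 1], unfold 4 cyclotomic_poly_1)
        (simp add: of_nat_diff)
    then show ?thesis by blast
  next
    case 5
    then have "e dvd q ^ 2 ^ a + 1"
      by (intro cyclotomic_value_dvd[OF k, of 1], unfold 5 cyclotomic_poly_power_2)
        (simp add: poly_monom)
    then show ?thesis by blast
  qed
qed

section \<open>Minimal sums of powers and packings of exponent vectors\<close>

text \<open>The minimum exists because \<open>e\<close> copies of \<open>q ^ 0\<close> have sum
  \<open>e\<close>.\<close>

lemma min_power_sum_length_witness:
  assumes "0 < e"
  shows "0 < min_power_sum_length q e"
    and "\<exists>i :: nat \<Rightarrow> nat. e dvd (\<Sum>k<min_power_sum_length q e. q ^ i k)"
proof -
  have "0 < e \<and> (\<exists>i :: nat \<Rightarrow> nat. e dvd (\<Sum>k<e. q ^ i k))"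
    using assms by (auto intro!: exI[of _ "\<lambda>_. 0"])
  from LeastI[of "\<lambda>t. 0 < t \<and> (\<exists>i :: nat \<Rightarrow> nat. e dvd (\<Sum>k<t. q ^ i k))", OF this]
  show "0 < min_power_sum_length q e"
    and "\<exists>i :: nat \<Rightarrow> nat. e dvd (\<Sum>k<min_power_sum_length q e. q ^ i k)"
    by (auto simp: min_power_sum_length_def)
qed

lemma min_power_sum_length_le:
  assumes "0 < t" and "e dvd (\<Sum>k<t. q ^ i k)"
  shows "min_power_sum_length q e \<le> t"
  unfolding min_power_sum_length_def using assms by (intro Least_le) auto

text \<open>As \<open>q\<close> is 1 modulo \<open>e\<close>, a sum of \<open>t\<close> powers of
  \<open>q\<close> is congruent to \<open>t\<close>.\<close>

lemma min_power_sum_length_eq_self: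
  assumes "0 < e" and "0 < q" and "e dvd q - 1"
  shows "min_power_sum_length q e = e"
proof (rule antisym)
  have "[q = 1] (mod e)"
    using assms by (metis One_nat_def Suc_leI cong_altdef_nat)
  then have pow: "[q ^ j = 1] (mod e)" for j
    using cong_pow[of q 1 e j] by simp
  obtain i :: "nat \<Rightarrow> nat" where "e dvd (\<Sum>k<min_power_sum_length q e. q ^ i k)"
    using min_power_sum_length_witness[OF \<open>0 < e\<close>] by blast
  moreover have "[(\<Sum>k<t. q ^ i k) = (\<Sum>k<t. 1)] (mod e)" for t
    by (intro cong_sum pow)
  ultimately have "e dvd min_power_sum_length q e"
    by (metis card_lessThan cong_dvd_iff sum_constant mult_1_right of_nat_id)
  then show "e \<le> min_power_sum_length q e"
    using min_power_sum_length_witness(1)[OF \<open>0 < e\<close>] by (rule dvd_imp_le)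
  show "min_power_sum_length q e \<le> e"
    using \<open>0 < e\<close> by (intro min_power_sum_length_le[where i = "\<lambda>_. 0"]) auto
qed

section \<open>Periods of \<open>q\<close> modulo \<open>e\<close> and the values 2 and 3 of the
  minimal length\<close>

lemma coprime_if_dvd_power_minus_1:
  fixes q n e :: nat
  assumes "0 < n" and "0 < q" and "e dvd q ^ n - 1"
  shows "coprime e q"
proof (rule coprimeI)
  fix c assume c: "c dvd e" "c dvd q"
  then have "c dvd q ^ n - 1" "c dvd q ^ n"
    using assms by (auto intro: dvd_trans dvd_power)
  moreover have "1 \<le> q ^ n" using \<open>0 < q\<close> by simp
  ultimately show "is_unit c" by (metis dvd_diffD1)
qed

text \<open>A single power of \<open>q\<close> is coprime to \<open>e\<close>, so it can be
  divisible by \<open>e\<close> only for \<open>e = 1\<close>, and 1 divides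
  \<open>q - 1\<close>.\<close>

lemma min_power_sum_length_gt_1:
  assumes "0 < e" and "coprime e q" and "\<not> e dvd q - 1"
  shows "1 < min_power_sum_length q e"
proof (rule ccontr)
  assume "\<not> ?thesis"
  then have one: "min_power_sum_length q e = 1"
    using min_power_sum_length_witness(1)[OF \<open>0 < e\<close>, of q] by simp
  obtain i :: "nat \<Rightarrow> nat" where "e dvd q ^ i 0"
    using min_power_sum_length_witness(2)[OF \<open>0 < e\<close>, of q] unfolding one by auto
  moreover have "coprime e (q ^ i 0)" using assms by simp
  ultimately have "e = 1" by (metis coprime_absorb_left nat_dvd_1_iff_1)
  with assms show False by simp
qed

lemma power_cong_1_gcd:
  fixes q e :: nat
  assumes "coprime e q" and "[q ^ a = 1] (mod e)" and "[q ^ b = 1] (mod e)"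
  shows "[q ^ gcd a b = 1] (mod e)"
proof (cases "a = 0")
  case False
  \<comment> \<open>Bezout in the form \<open>a * x = b * y + gcd a b\<close> keeps all exponents
    nonnegative, so \<open>q\<close> never has to be inverted modulo \<open>e\<close>.\<close>
  then obtain x y where xy: "a * x = b * y + gcd a b" using bezout_nat by blast
  have "[q ^ gcd a b = 1 ^ y * q ^ gcd a b] (mod e)" by simp
  also have "[1 ^ y * q ^ gcd a b = (q ^ b) ^ y * q ^ gcd a b] (mod e)"
    using assms(3) by (intro cong_mult cong_pow cong_refl) (rule cong_sym)
  also have "(q ^ b) ^ y * q ^ gcd a b = (q ^ a) ^ x"
    by (simp flip: power_mult power_add add: xy)
  also have "[(q ^ a) ^ x = 1 ^ x] (mod e)"
    using assms(2) by (rule cong_pow)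
  finally show ?thesis by simp
qed (use assms in simp)

text \<open>The given \<open>2 * h\<close> need not divide \<open>n\<close>, so it is replaced by
  the period \<open>g = gcd n (2 * h)\<close>. The quotient of \<open>2 * h\<close> by
  \<open>g\<close> is odd, since otherwise \<open>g\<close> divides \<open>h\<close> and
  \<open>q ^ h\<close> is 1. Hence \<open>g\<close> is even and \<open>h\<close> is congruent to
  \<open>g / 2\<close> modulo \<open>g\<close>, which gives \<open>q ^ (g / 2)\<close> the residue
  -1 as well.\<close>

lemma half_period:
  fixes q n e h :: nat
  assumes "0 < n" and "0 < q" and "e dvd q ^ n - 1" and "\<not> e dvd q - 1"
    and "e dvd q ^ h + 1"
  shows "\<exists>g>0. e dvd q ^ g + 1 \<and> 2 * g dvd n"
proof -
  have coprime: "coprime e q" using assms coprime_if_dvd_power_minus_1 by blast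
  have one_n: "[q ^ n = 1] (mod e)"
    using assms by (metis One_nat_def Suc_leI cong_altdef_nat zero_less_power)
  \<comment> \<open>If \<open>q ^ h\<close> were both 1 and -1, then \<open>e\<close> would divide
    2. For \<open>e = 2\<close> coprimality makes \<open>q\<close> odd, so \<open>e\<close> would
    divide \<open>q - 1\<close> in either case.\<close>
  have not_one: "\<not> [q ^ h = 1] (mod e)"
  proof
    assume "[q ^ h = 1] (mod e)"
    then have "[q ^ h + 1 = 1 + 1] (mod e)" by (intro cong_add) simp_all
    with \<open>e dvd q ^ h + 1\<close> have "e dvd 2" by (metis cong_dvd_iff one_add_one)
    then have "e = 1 \<or> e = 2" using two_is_prime_nat prime_nat_iff by blast
    moreover have "odd q \<or> e \<noteq> 2" using coprime by auto
    ultimately have "e dvd q - 1" by auto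
    with assms show False by blast
  qed
  have "int e dvd int (q ^ h + 1)" using assms(5) by (simp only: int_dvd_int_iff)
  then have "int e dvd (int q ^ h + 1) * (int q ^ h - 1)" by (simp add: add.commute)
  also have "(int q ^ h + 1) * (int q ^ h - 1) = int q ^ (2 * h) - 1"
    by (simp add: algebra_simps flip: power_add mult_2)
  finally have "[int q ^ (2 * h) = 1] (mod int e)" by (simp add: cong_iff_dvd_diff)
  then have one_2h: "[q ^ (2 * h) = 1] (mod e)"
    by (metis cong_int_iff of_nat_1 of_nat_power)
  define g where "g = gcd n (2 * h)"
  have one_g: "[q ^ g = 1] (mod e)"
    unfolding g_def using coprime one_n one_2h by (rule power_cong_1_gcd)
  then have one_mult: "[q ^ (g * k) = 1] (mod e)" for k
    using cong_pow[OF one_g, of k] by (simp add: power_mult)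
  have "g dvd 2 * h" "g dvd n" by (simp_all add: g_def)
  then obtain k where k: "2 * h = g * k" by blast
  have "odd k"
  proof
    assume "even k"
    then obtain l where "k = 2 * l" by blast
    with k have "h = g * l" by simp
    with one_mult not_one show False by blast
  qed
  then obtain l where l: "k = 2 * l + 1" by (rule oddE)
  have "even g" using k \<open>odd k\<close> by (metis dvd_triv_left even_mult_iff)
  then obtain g' where g': "g = 2 * g'" by blast
  have "h = g * l + g'" using k unfolding l g' by (simp add: algebra_simps)
  then have "[q ^ h = 1 * q ^ g'] (mod e)"
    unfolding power_add \<open>h = _\<close> by (intro cong_mult one_mult cong_refl)
  then have "[q ^ h + 1 = q ^ g' + 1] (mod e)" by (intro cong_add) simp_all
  with assms(5) have "e dvd q ^ g' + 1" using cong_dvd_iff by blast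
  moreover have "2 * g' dvd n" using \<open>g dvd n\<close> g' by simp
  moreover have "0 < g'" using \<open>2 * g' dvd n\<close> \<open>0 < n\<close> by (cases g') auto
  ultimately show ?thesis by blast
qed

lemma min_power_sum_length_eq_2:
  fixes q n e h :: nat
  assumes "0 < n" and "0 < q" and "0 < e" and "e dvd q ^ n - 1" and "\<not> e dvd q - 1"
    and "e dvd q ^ h + 1"
  shows "min_power_sum_length q e = 2"
    and "\<exists>g>0. e dvd (\<Sum>i<2. q ^ (i * g)) \<and> 2 * g dvd n"
proof -
  have "1 < min_power_sum_length q e"
    using assms min_power_sum_length_gt_1 coprime_if_dvd_power_minus_1 by blast
  moreover have "min_power_sum_length q e \<le> 2"
    using assms(6)
    by (intro min_power_sum_length_le[where i = "\<lambda>k. k * h"]) (simp_all add: numeral_2_eq_2)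
  ultimately show "min_power_sum_length q e = 2" by simp
  show "\<exists>g>0. e dvd (\<Sum>i<2. q ^ (i * g)) \<and> 2 * g dvd n"
    using half_period[OF assms(1,2,4,5,6)] by (simp add: numeral_2_eq_2)
qed

text \<open>Modulo \<open>e\<close> the power \<open>q ^ 9\<close> is 1 but \<open>q ^ 3\<close> is
  not. This forces 9 to divide \<open>n\<close>, and it rules out length 2 because the odd period 9
  is incompatible with a power of \<open>q\<close> being -1. The sum
  \<open>1 + q ^ 3 + q ^ 6\<close> shows that three terms suffice.\<close>

lemma min_power_sum_length_eq_3:
  fixes q n e :: nat
  assumes "0 < n" and "0 < q" and "0 < e" and "e dvd q ^ n - 1" and "\<not> e dvd q - 1"
    and "e dvd q ^ 6 + q ^ 3 + 1"
  shows "min_power_sum_length q e = 3" and "e dvd (\<Sum>i<3. q ^ (i * 3))" and "3 * 3 dvd n"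
proof -
  have coprime: "coprime e q" using assms coprime_if_dvd_power_minus_1 by blast
  show sum: "e dvd (\<Sum>i<3. q ^ (i * 3))"
    using assms(6) by (simp add: numeral_3_eq_3 eval_nat_numeral algebra_simps)
  have one_n: "[q ^ n = 1] (mod e)"
    using assms by (metis One_nat_def Suc_leI cong_altdef_nat zero_less_power)
  have "int e dvd int (q ^ 6 + q ^ 3 + 1)" using assms(6) by (simp only: int_dvd_int_iff)
  then have "int e dvd (int q ^ 6 + int q ^ 3 + 1) * (int q ^ 3 - 1)"
    by (intro dvd_mult2) (simp add: algebra_simps)
  also have "\<dots> = int q ^ 9 - 1" by (simp add: algebra_simps flip: power_add)
  finally have "[int q ^ 9 = 1] (mod int e)" by (simp add: cong_iff_dvd_diff)
  then have one_9: "[q ^ 9 = 1] (mod e)"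
    by (metis cong_int_iff of_nat_1 of_nat_power)
  have not_3: "\<not> [q ^ 3 = 1] (mod e)"
  proof
    assume one_3: "[q ^ 3 = 1] (mod e)"
    \<comment> \<open>All three terms become 1, so \<open>e\<close> divides 3.\<close>
    have "[q ^ 6 = 1] (mod e)" using cong_pow[OF one_3, of 2] by simp
    then have "[q ^ 6 + q ^ 3 + 1 = 1 + 1 + 1] (mod e)"
      using one_3 by (intro cong_add) simp_all
    with assms(6) have "e dvd 3" by (metis cong_dvd_iff numeral_3_eq_3 One_nat_def add_Suc_right add_0_right)
    moreover have "Factorial_Ring.prime (3::nat)" by simp
    ultimately have "e = 1 \<or> e = 3" using prime_nat_iff by blast
    then have "e = 3" using assms(5) by auto
    \<comment> \<open>Cubing is the identity modulo 3.\<close>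
    have "[q = 1] (mod 3)"
    proof -
      have "q mod 3 = 0 \<or> q mod 3 = 1 \<or> q mod 3 = 2" by arith
      moreover have "(q ^ 3) mod 3 = ((q mod 3) ^ 3) mod 3" by (simp add: power_mod)
      ultimately show ?thesis using one_3 \<open>e = 3\<close> by (auto simp: cong_def)
    qed
    then have "e dvd q - 1" using \<open>e = 3\<close> \<open>0 < q\<close>
      by (metis One_nat_def Suc_leI cong_altdef_nat)
    with assms show False by blast
  qed
  \<comment> \<open>The number \<open>gcd n 9\<close> is a power of 3 and a period of
    \<open>q\<close>. If it were 1 or 3, then \<open>q ^ 3\<close> would be 1 modulo
    \<open>e\<close>, so it is 9.\<close>
  have "gcd n 9 dvd 3 ^ 2" by simp
  then obtain r where r: "gcd n 9 = 3 ^ r" "r \<le> 2"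
    using divides_primepow_nat[of 3 "gcd n 9" 2] by auto
  have one_r: "[q ^ (3 ^ r) = 1] (mod e)"
    using power_cong_1_gcd[OF coprime one_n one_9] r by simp
  have "r = 2"
  proof (rule ccontr)
    assume "r \<noteq> 2"
    with r have "r = 0 \<or> r = 1" by auto
    then have "[q ^ 3 = 1] (mod e)"
      using one_r cong_pow[OF one_r, of 3] by auto
    with not_3 show False by blast
  qed
  with r show "3 * 3 dvd n" by (metis gcd_dvd1 power2_eq_square)
  \<comment> \<open>The terms \<open>q ^ 6\<close> and \<open>q ^ 3\<close> have the same parity, so
    \<open>e\<close> divides an odd number.\<close>
  have odd_e: "odd e"
  proof
    assume "even e"
    then have "even (q ^ 6 + q ^ 3 + 1)" using assms(6) dvd_trans by blast
    then show False by simp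
  qed
  have not_2: "min_power_sum_length q e \<noteq> 2"
  proof
    assume two: "min_power_sum_length q e = 2"
    have "\<exists>i :: nat \<Rightarrow> nat. e dvd (\<Sum>k<2. q ^ i k)"
      using min_power_sum_length_witness(2)[OF \<open>0 < e\<close>, of q] two by simp
    then obtain a b where "e dvd q ^ a + q ^ b" by (auto simp: numeral_2_eq_2)
    \<comment> \<open>The smaller of the two powers is a unit modulo \<open>e\<close> and can be
      divided out.\<close>
    moreover have "\<exists>h. e dvd q ^ h + 1" if "a \<le> b" "e dvd q ^ a + q ^ b" for a b
    proof -
      have "q ^ a + q ^ b = q ^ a * (q ^ (b - a) + 1)"
        using that by (simp add: algebra_simps flip: power_add)
      moreover have "coprime e (q ^ a)" using coprime by simp
      ultimately show ?thesis using that by (metis coprime_dvd_mult_right_iff)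
    qed
    ultimately obtain h where "e dvd q ^ h + 1"
      by (metis add.commute linorder_linear)
    then have "int e dvd int (q ^ h + 1)" by (simp only: int_dvd_int_iff)
    then have "[int q ^ h = - 1] (mod int e)" by (simp add: cong_iff_dvd_diff add.commute)
    \<comment> \<open>The ninth power of \<open>q ^ h\<close> is 1 since 9 is a period, while that
      of -1 is -1. So \<open>e\<close> divides 2, and being odd it is 1.\<close>
    then have "[(int q ^ h) ^ 9 = (- 1) ^ 9] (mod int e)" by (rule cong_pow)
    moreover have "[(int q ^ 9) ^ h = 1 ^ h] (mod int e)"
      by (rule cong_pow) fact
    ultimately have "[1 = - 1] (mod int e)"
      by (metis (no_types, lifting) cong_sym cong_trans power_mult mult.commute power_one
          power_minus_odd odd_numeral)
    then have "int e dvd int 2" by (simp add: cong_iff_dvd_diff)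
    then have "e dvd 2" by (simp only: int_dvd_int_iff)
    then have "e = 1" using odd_e two_is_prime_nat prime_nat_iff by blast
    with assms show False by simp
  qed
  have "1 < min_power_sum_length q e"
    using assms min_power_sum_length_gt_1 coprime by blast
  moreover have "min_power_sum_length q e \<le> 3"
    using sum by (intro min_power_sum_length_le) auto
  ultimately show "min_power_sum_length q e = 3" using not_2 by simp
qed

section \<open>Weights and degrees of exponent vectors\<close>

definition monomial_weight :: "nat \<Rightarrow> nat \<Rightarrow> (nat \<Rightarrow>\<^sub>0 nat) \<Rightarrow> nat" where
  "monomial_weight q n t = (\<Sum>j<n. q ^ j * Poly_Mapping.lookup t j)"

definition monomial_degree :: "nat \<Rightarrow> (nat \<Rightarrow>\<^sub>0 nat) \<Rightarrow> nat" where
  "monomial_degree n t = (\<Sum>j<n. Poly_Mapping.lookup t j)"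

lemma monomial_weight_add:
  "monomial_weight q n (s + t) = monomial_weight q n s + monomial_weight q n t"
  by (simp add: monomial_weight_def lookup_add sum.distrib algebra_simps)

lemma monomial_degree_add:
  "monomial_degree n (s + t) = monomial_degree n s + monomial_degree n t"
  by (simp add: monomial_degree_def lookup_add sum.distrib)

lemma monomial_weight_sum:
  "monomial_weight q n (sum f A) = (\<Sum>a\<in>A. monomial_weight q n (f a))"
  by (induction A rule: infinite_finite_induct)
    (auto simp: monomial_weight_add, simp_all add: monomial_weight_def)

lemma monomial_weight_single:
  assumes "j < n"
  shows "monomial_weight q n (Poly_Mapping.single j k) = q ^ j * k"
  using assms unfolding monomial_weight_def lookup_single when_def
  by (subst sum.cong[OF refl, of _ _ "\<lambda>i. if i = j then q ^ j * k else 0"]) auto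

lemma monomial_degree_eq_0_iff:
  assumes "Poly_Mapping.keys t \<subseteq> {..<n}"
  shows "monomial_degree n t = 0 \<longleftrightarrow> t = 0"
proof
  assume *: "monomial_degree n t = 0"
  show "t = 0"
  proof (rule poly_mapping_eqI)
    fix j show "Poly_Mapping.lookup t j = Poly_Mapping.lookup 0 j"
      using * assms by (cases "j < n") (auto simp: monomial_degree_def in_keys_iff)
  qed
qed (simp add: monomial_degree_def)

text \<open>Listing each index \<open>j\<close> as often as the exponent of variable
  \<open>j\<close> says writes the weight as a sum of \<open>monomial_degree n t\<close> powers of
  \<open>q\<close>, which competes in the minimum.\<close>

lemma min_power_sum_length_le_degree:
  assumes "e dvd monomial_weight q n t" and "0 < monomial_degree n t"
  shows "min_power_sum_length q e \<le> monomial_degree n t"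
proof -
  have "\<exists>xs. length xs = (\<Sum>j<n. f j) \<and> (\<Sum>x\<leftarrow>xs. q ^ x) = (\<Sum>j<n. q ^ j * f j)"
    for f :: "nat \<Rightarrow> nat"
  proof (induction n)
    case (Suc n)
    then obtain xs where "length xs = (\<Sum>j<n. f j)" "(\<Sum>x\<leftarrow>xs. q ^ x) = (\<Sum>j<n. q ^ j * f j)"
      by blast
    then show ?case
      by (intro exI[of _ "xs @ replicate (f n) n"]) (simp add: sum_list_replicate)
  qed simp
  then obtain xs where xs: "length xs = monomial_degree n t"
    "(\<Sum>x\<leftarrow>xs. q ^ x) = monomial_weight q n t"
    unfolding monomial_degree_def monomial_weight_def by blast
  then have "e dvd (\<Sum>k<monomial_degree n t. q ^ (xs ! k))"
    using assms by (simp add: sum_list_sum_nth atLeast0LessThan)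
  then show ?thesis using assms by (intro min_power_sum_length_le)
qed

text \<open>
  \<open>N\<close> exponent vectors of monomials of the algebra whose product is nonzero in the truncated ring.
  The index type carries no meaning: it is large enough for block number, offset and copy.
\<close>

definition admissible_packing ::
    "nat \<Rightarrow> nat \<Rightarrow> nat \<Rightarrow> nat \<Rightarrow> bool" where
  "admissible_packing q n e N \<longleftrightarrow> (\<exists>(S :: (nat \<times> nat \<times> nat) set) (v :: nat \<times> nat \<times> nat \<Rightarrow> nat \<Rightarrow>\<^sub>0 nat). finite S \<and> card S = N \<and>
     (\<forall>s\<in>S. v s \<noteq> 0 \<and> Poly_Mapping.keys (v s) \<subseteq> {..<n} \<and> e dvd monomial_weight q n (v s)) \<and>
     (\<forall>j. Poly_Mapping.lookup (\<Sum>s\<in>S. v s) j < q))"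

text \<open>The \<open>e\<close>-th power of each variable is used \<open>(q - 1) div e\<close>
  times, which brings its exponent to exactly \<open>q - 1\<close>.\<close>

lemma packing_powers:
  assumes "0 < q" and "0 < e" and "e dvd q - 1"
  shows "admissible_packing q n e (n * ((q - 1) div e))"
proof -
  define c where "c = (q - 1) div e"
  have c: "c * e = q - 1" using assms by (simp add: c_def)
  \<comment> \<open>Variable and copy number suffice as indices here; the one-element third factor
    only fits the index type.\<close>
  define S where "S = {..<n} \<times> {..<c} \<times> {..<1::nat}"
  define v where "v = (\<lambda>(j :: nat, k :: nat, l :: nat). Poly_Mapping.single j e)"
  have "Poly_Mapping.lookup (\<Sum>s\<in>S. v s) x = (\<Sum>j<n. \<Sum>k<c. e when j = x)" for x
    unfolding lookup_sum S_def v_def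
    by (simp add: sum.cartesian_product' lookup_single lessThan_Suc)
  also have "\<dots> x = (if x < n then c * e else 0)" for x
    by (simp add: when_def if_distrib cong: if_cong)
  finally have "\<forall>x. Poly_Mapping.lookup (\<Sum>s\<in>S. v s) x < q" using c \<open>0 < q\<close> by auto
  moreover have "finite S" "card S = n * c" by (simp_all add: S_def)
  moreover have "\<forall>s\<in>S. v s \<noteq> 0 \<and> Poly_Mapping.keys (v s) \<subseteq> {..<n} \<and> e dvd monomial_weight q n (v s)"
    using \<open>0 < e\<close> by (auto simp: S_def v_def monomial_weight_single simp flip: keys_eq_empty)
  ultimately show ?thesis unfolding admissible_packing_def c_def by blast
qed

text \<open>The variables are cut into \<open>b\<close> intervals of length \<open>m * h\<close>,
  and each interval into its \<open>h\<close> residue classes modulo \<open>h\<close>. A class has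
  \<open>m\<close> members with spacing \<open>h\<close>, so the weight of their product is a power
  of \<open>q\<close> times the given sum. Distinct classes are disjoint, so each can be used
  \<open>q - 1\<close> times.\<close>

lemma packing_blocks:
  assumes "0 < q" and "0 < m" and "0 < h" and "e dvd (\<Sum>i<m. q ^ (i * h))"
  shows "admissible_packing q (b * (m * h)) e (b * h * (q - 1))"
proof -
  define n where "n = b * (m * h)"
  \<comment> \<open>The position of member \<open>i\<close> of the class with offset
    \<open>r\<close> in interval \<open>b\<close>. Since \<open>i < m\<close> and
    \<open>r < h\<close>, division with remainder recovers all three numbers.\<close>
  define p where "p = (\<lambda>b r i. (b * m + i) * h + r)"
  define S where "S = {..<b} \<times> {..<h} \<times> {..<q - 1}"
  \<comment> \<open>The vector ignores \<open>k\<close>, which only counts the \<open>q - 1\<close>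
    copies.\<close>
  define v where "v = (\<lambda>(b, r, k :: nat). \<Sum>i<m. Poly_Mapping.single (p b r i) (1::nat))"
  have p_less: "p a r i < n" if "a < b" "r < h" "i < m" for a r i
  proof -
    have "p a r i < (a * m + i + 1) * h" using that by (simp add: p_def)
    also have "\<dots> \<le> (a * m + m) * h" using that by (intro mult_right_mono) auto
    also have "\<dots> = (a + 1) * (m * h)" by (simp add: algebra_simps)
    also have "\<dots> \<le> n" unfolding n_def using that by (intro mult_right_mono) auto
    finally show ?thesis .
  qed
  have p_inj: "a = x div h div m \<and> r = x mod h \<and> i = (x div h) mod m"
    if "p a r i = x" "r < h" "i < m" for a r i x
    using that unfolding p_def by auto
  have v_nonzero: "v s \<noteq> 0" for s
  proof -
    obtain a r k where s: "s = (a, r, k)" by (cases s)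
    have "1 \<le> Poly_Mapping.lookup (Poly_Mapping.single (p a r 0) (1::nat)) (p a r 0)" by simp
    also have "\<dots> \<le> Poly_Mapping.lookup (v s) (p a r 0)"
      unfolding s v_def prod.case lookup_sum using \<open>0 < m\<close> by (intro member_le_sum) auto
    finally show ?thesis by auto
  qed
  have v_keys: "Poly_Mapping.keys (v s) \<subseteq> {..<n}" if "s \<in> S" for s
    using that p_less unfolding S_def v_def by (force dest!: subsetD[OF keys_sum])
  have v_weight: "e dvd monomial_weight q n (v s)" if "s \<in> S" for s
  proof -
    obtain a r k where s: "s = (a, r, k)" "a < b" "r < h" using \<open>s \<in> S\<close> by (auto simp: S_def)
    have "monomial_weight q n (v s) = (\<Sum>i<m. q ^ p a r i)"
      using s p_less by (simp add: v_def monomial_weight_sum monomial_weight_single)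
    also have "\<dots> = q ^ (a * m * h + r) * (\<Sum>i<m. q ^ (i * h))"
      by (simp add: sum_distrib_left p_def algebra_simps power_add)
    finally show ?thesis using assms by simp
  qed
  have "Poly_Mapping.lookup (\<Sum>s\<in>S. v s) x < q" for x
  proof -
    define A R I where ARI: "A = x div h div m" "R = x mod h" "I = (x div h) mod m"
    have p_unique: "a = A \<and> r = R \<and> i = I" if "p a r i = x" "r < h" "i < m" for a r i
      using p_inj[OF that] by (simp add: ARI)
    have "Poly_Mapping.lookup (\<Sum>s\<in>S. v s) x =
        (\<Sum>a<b. \<Sum>r<h. \<Sum>k<q - 1. \<Sum>i<m. if p a r i = x then 1 else 0)"
      unfolding lookup_sum S_def v_def
      by (simp add: sum.cartesian_product' lookup_sum lookup_single when_def cong: if_cong)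
    \<comment> \<open>At most one triple of interval, offset and member hits the position
      \<open>x\<close>. Bounding the indicator by a product of three indicators makes the sum
      factor, and only the sum over the copies exceeds 1.\<close>
    also have "\<dots> \<le> (\<Sum>a<b. \<Sum>r<h. \<Sum>k<q - 1. \<Sum>i<m.
        of_bool (a = A) * (of_bool (r = R) * of_bool (i = I)))"
      using p_unique by (intro sum_mono) auto
    also have "\<dots> = (\<Sum>a<b. of_bool (a = A)) * ((\<Sum>r<h. of_bool (r = R)) *
        ((q - 1) * (\<Sum>i<m. of_bool (i = I))))"
    proof -
      have "(\<Sum>a<b. \<Sum>r<h. \<Sum>k<q - 1. \<Sum>i<m. f a * (g r * w i)) =
          sum f {..<b} * (sum g {..<h} * ((q - 1) * sum w {..<m}))" for f g w :: "nat \<Rightarrow> nat"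
      proof -
        have "(\<Sum>k<q - 1. \<Sum>i<m. f a * (g r * w i)) = f a * (g r * ((q - 1) * sum w {..<m}))" for a r
          by (simp add: sum_distrib_left ac_simps)
        then show ?thesis by (simp flip: sum_distrib_left sum_distrib_right)
      qed
      then show ?thesis .
    qed
    also have "\<dots> \<le> 1 * (1 * ((q - 1) * 1))"
    proof -
      have "(\<Sum>i<k. of_bool (i = j)) \<le> (1::nat)" for k j :: nat
        by (simp add: of_bool_def)
      then show ?thesis by (intro mult_le_mono le_refl)
    qed
    finally show ?thesis using \<open>0 < q\<close> by linarith
  qed
  moreover have "finite S" "card S = b * h * (q - 1)" by (simp_all add: S_def)
  ultimately show ?thesis
    unfolding admissible_packing_def using v_nonzero v_keys v_weight unfolding n_def by blast
qed

text \<open>Each vector of the packings constructed above has degree equal to the minimal length,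
  and together they use up the whole available degree \<open>n * (q - 1)\<close>.\<close>

lemma optimal_packing:
  fixes q n e :: nat
  assumes "0 < n" and "0 < e" and "0 < q" and "e dvd q ^ n - 1"
    and "e dvd q - 1 \<or> (\<exists>h. e dvd q ^ h + 1) \<or> e dvd q ^ 6 + q ^ 3 + 1"
  shows "\<exists>N. admissible_packing q n e N \<and> N * min_power_sum_length q e = n * (q - 1)"
proof (cases "e dvd q - 1")
  case True
  with assms packing_powers[of q e n] show ?thesis
    by (intro exI[of _ "n * ((q - 1) div e)"]) (simp add: min_power_sum_length_eq_self mult.assoc)
next
  case False
  define m where "m = min_power_sum_length q e"
  have "0 < m" using min_power_sum_length_witness(1)[OF \<open>0 < e\<close>] by (simp add: m_def)
  have "\<exists>h>0. e dvd (\<Sum>i<m. q ^ (i * h)) \<and> m * h dvd n"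
  proof (cases "\<exists>h. e dvd q ^ h + 1")
    case True
    then show ?thesis
      using min_power_sum_length_eq_2[OF assms(1,3,2,4) False] unfolding m_def by auto
  next
    case no_h: False
    with assms(5) False have "e dvd q ^ 6 + q ^ 3 + 1" by blast
    then show ?thesis
      using min_power_sum_length_eq_3[OF assms(1,3,2,4) False] unfolding m_def
      by (intro exI[of _ 3]) simp
  qed
  then obtain h where h: "0 < h" "e dvd (\<Sum>i<m. q ^ (i * h))" "m * h dvd n" by blast
  then obtain b where b: "n = b * (m * h)" by (metis dvdE mult.commute)
  have "admissible_packing q n e (b * h * (q - 1))"
    unfolding b using packing_blocks \<open>0 < q\<close> \<open>0 < m\<close> h by blast
  moreover have "b * h * (q - 1) * m = n * (q - 1)" by (simp add: b ac_simps)
  ultimately show ?thesis unfolding m_def by blast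
qed

section \<open>The radical filtration\<close>

text \<open>Invertibility modulo \<open>N\<close> of every element outside \<open>N\<close> makes
  \<open>N\<close> maximal. Its elements are nilpotent, so they lie in every prime and hence in
  every maximal ideal.\<close>

lemma (in cring) jacobson_radical_eq_nil_maximal_ideal:
  assumes "ideal N R" and "\<one> \<notin> N"
    and nilpotent: "\<And>x. x \<in> N \<Longrightarrow> \<exists>k::nat. x [^] k = \<zero>"
    and invertible: "\<And>x. x \<in> carrier R \<Longrightarrow> x \<notin> N \<Longrightarrow> \<exists>y\<in>carrier R. \<exists>z\<in>N. x \<otimes> y = \<one> \<oplus> z"
  shows "jacobson_radical R = N"
proof
  interpret N: ideal N R by fact
  have "maximalideal N R"
  proof (rule maximalidealI)
    fix M assume M: "ideal M R" "N \<subseteq> M" "M \<subseteq> carrier R"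
    interpret M: ideal M R by fact
    show "M = N \<or> M = carrier R"
    proof (cases "M = N")
      case False
      then obtain x where x: "x \<in> M" "x \<notin> N" using M by blast
      then obtain y z where yz: "y \<in> carrier R" "z \<in> N" "x \<otimes> y = \<one> \<oplus> z"
        using invertible[of x] x(2) subsetD[OF M(3) x(1)] by metis
      have "z \<in> carrier R" using yz by auto
      then have "\<one> = x \<otimes> y \<oplus> \<ominus> z"
        using yz by (simp add: a_assoc r_neg)
      moreover have "x \<otimes> y \<in> M" using x yz M.I_r_closed by blast
      moreover have "\<ominus> z \<in> M" using yz M by (metis M.a_inv_closed subsetD)
      ultimately have "\<one> \<in> M" by (metis M.a_closed)
      then show ?thesis using M.one_imp_carrier by blast
    qed simp
  qed (use assms in auto)
  then show "jacobson_radical R \<subseteq> N" by (auto simp: jacobson_radical_def)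
  show "N \<subseteq> jacobson_radical R"
  proof
    fix x assume x: "x \<in> N"
    then have x_carrier: "x \<in> carrier R" by auto
    have "x \<in> M" if "maximalideal M R" for M
    proof -
      interpret M: primeideal M R using maximalideal_prime[OF that] .
      have "x \<in> M" if "x [^] (k::nat) \<in> M" for k
        using that
      proof (induction k)
        case 0
        then have "carrier R = M" using M.one_imp_carrier by simp
        then show ?case using M.I_notcarr by simp
      next
        case (Suc k)
        then show ?case using M.I_prime[of "x [^] k" x] x_carrier by auto
      qed
      with nilpotent[OF x] show ?thesis using M.zero_closed by metis
    qed
    with x_carrier show "x \<in> jacobson_radical R" by (auto simp: jacobson_radical_def)
  qed
qed

section \<open>Polynomials with restricted support and the truncated ring\<close>

text \<open>The relevant ideals and subrings of the polynomial ring are spanned by monomials, so a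
  set of permitted exponent vectors describes each of them.\<close>

definition supported_on :: "'t set \<Rightarrow> ('t \<Rightarrow>\<^sub>0 'a::zero) set" where
  "supported_on S = {p. Poly_Mapping.keys p \<subseteq> S}"

lemma supported_on_mono: "S \<subseteq> T \<Longrightarrow> supported_on S \<subseteq> supported_on T"
  by (auto simp: supported_on_def)

lemma supported_on_0 [simp]: "0 \<in> supported_on S"
  by (simp add: supported_on_def)

lemma supported_on_single: "s \<in> S \<Longrightarrow> Poly_Mapping.single s c \<in> supported_on S"
  by (simp add: supported_on_def)

lemma supported_on_add:
  fixes p r :: "'t \<Rightarrow>\<^sub>0 'a::monoid_add"
  shows "p \<in> supported_on S \<Longrightarrow> r \<in> supported_on S \<Longrightarrow> p + r \<in> supported_on S"
  using Poly_Mapping.keys_add[of p r] by (auto simp: supported_on_def)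

lemma supported_on_uminus:
  fixes p :: "'t \<Rightarrow>\<^sub>0 'a::ab_group_add"
  shows "p \<in> supported_on S \<Longrightarrow> - p \<in> supported_on S"
  by (auto simp: supported_on_def in_keys_iff)

lemma supported_on_mult:
  fixes p r :: "'t::monoid_add \<Rightarrow>\<^sub>0 'a::semiring_0"
  assumes "p \<in> supported_on S" and "r \<in> supported_on T"
    and "\<And>s t. s \<in> S \<Longrightarrow> t \<in> T \<Longrightarrow> s + t \<in> U"
  shows "p * r \<in> supported_on U"
  using Poly_Mapping.keys_mult[of p r] assms by (fastforce simp: supported_on_def)

lemma sum_single_keys:
  "(\<Sum>t\<in>Poly_Mapping.keys p. Poly_Mapping.single t (Poly_Mapping.lookup p t)) = p"
  by (rule poly_mapping_eqI) (auto simp: lookup_sum lookup_single when_def in_keys_iff)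

definition variables_below :: "nat \<Rightarrow> (nat \<Rightarrow>\<^sub>0 nat) set" where
  "variables_below n = {t. Poly_Mapping.keys t \<subseteq> {..<n}}"

lemma variables_below_0 [simp]: "0 \<in> variables_below n"
  by (simp add: variables_below_def)

lemma variables_below_add:
  "s \<in> variables_below n \<Longrightarrow> t \<in> variables_below n \<Longrightarrow> s + t \<in> variables_below n"
  using Poly_Mapping.keys_add[of s t] by (auto simp: variables_below_def)

lemma variables_below_sum:
  "(\<And>i. i \<in> I \<Longrightarrow> f i \<in> variables_below n) \<Longrightarrow> sum f I \<in> variables_below n"
  by (induction I rule: infinite_finite_induct) (auto intro: variables_below_add)

lemma mpoly_ring_simps [simp]:
  "carrier (mpoly_ring n) = supported_on (variables_below n)"
  "x \<otimes>\<^bsub>mpoly_ring n\<^esub> y = x * y" "\<one>\<^bsub>mpoly_ring n\<^esub> = 1"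
  "x \<oplus>\<^bsub>mpoly_ring n\<^esub> y = x + y" "\<zero>\<^bsub>mpoly_ring n\<^esub> = 0"
  by (auto simp: mpoly_ring_def supported_on_def variables_below_def)

lemma one_supported_on: "0 \<in> S \<Longrightarrow> (1 :: 't::zero \<Rightarrow>\<^sub>0 'a::zero_neq_one) \<in> supported_on S"
  by (simp add: supported_on_def)

lemma mpoly_ring_mult_closed:
  assumes "p \<in> supported_on (variables_below n)" and "r \<in> supported_on (variables_below n)"
  shows "p * r \<in> supported_on (variables_below n)"
  using assms variables_below_add by (rule supported_on_mult)

lemma cring_mpoly_ring: "cring (mpoly_ring n :: ((nat \<Rightarrow>\<^sub>0 nat) \<Rightarrow>\<^sub>0 'a::comm_ring_1) ring)"
proof (rule cringI)
  show "abelian_group (mpoly_ring n :: ((nat \<Rightarrow>\<^sub>0 nat) \<Rightarrow>\<^sub>0 'a) ring)"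
  proof (rule abelian_groupI)
    fix p :: "(nat \<Rightarrow>\<^sub>0 nat) \<Rightarrow>\<^sub>0 'a" assume "p \<in> carrier (mpoly_ring n)"
    then show "\<exists>r\<in>carrier (mpoly_ring n). r \<oplus>\<^bsub>mpoly_ring n\<^esub> p = \<zero>\<^bsub>mpoly_ring n\<^esub>"
      by (intro bexI[of _ "- p"]) (auto intro: supported_on_uminus)
  qed (auto intro: supported_on_add simp: ac_simps)
  show "Group.comm_monoid (mpoly_ring n :: ((nat \<Rightarrow>\<^sub>0 nat) \<Rightarrow>\<^sub>0 'a) ring)"
    by (rule comm_monoidI)
      (auto intro: mpoly_ring_mult_closed one_supported_on simp: ac_simps)
qed (auto simp: algebra_simps)

lemma mpoly_ring_uminus:
  assumes "p \<in> supported_on (variables_below n)"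
  shows "\<ominus>\<^bsub>mpoly_ring n\<^esub> p = - (p :: (nat \<Rightarrow>\<^sub>0 nat) \<Rightarrow>\<^sub>0 'a::comm_ring_1)"
proof -
  interpret cring "mpoly_ring n :: ((nat \<Rightarrow>\<^sub>0 nat) \<Rightarrow>\<^sub>0 'a) ring" by (rule cring_mpoly_ring)
  show ?thesis
    by (rule minus_equality) (use assms in \<open>auto intro: supported_on_uminus\<close>)
qed

lemma mpoly_ring_additive_subgroup:
  assumes "S \<subseteq> variables_below n"
  shows "subgroup (supported_on S) (add_monoid (mpoly_ring n :: ((nat \<Rightarrow>\<^sub>0 nat) \<Rightarrow>\<^sub>0 'a::comm_ring_1) ring))"
proof -
  interpret cring "mpoly_ring n :: ((nat \<Rightarrow>\<^sub>0 nat) \<Rightarrow>\<^sub>0 'a) ring" by (rule cring_mpoly_ring)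
  note mono = supported_on_mono[OF assms]
  show ?thesis
  proof (rule add.subgroupI)
    fix p assume p: "p \<in> (supported_on S :: ((nat \<Rightarrow>\<^sub>0 nat) \<Rightarrow>\<^sub>0 'a) set)"
    then have "\<ominus>\<^bsub>mpoly_ring n\<^esub> p = - p" using mono mpoly_ring_uminus by blast
    then show "\<ominus>\<^bsub>mpoly_ring n\<^esub> p \<in> supported_on S" using supported_on_uminus[OF p] by simp
  qed (use mono in \<open>auto intro: supported_on_add supported_on_0\<close>)
qed

text \<open>The ideal is generated by monomials. The right side is an ideal containing the
  generators; conversely a polynomial is the sum of its terms, and each permitted term is a multiple
  of some generator. Vanishing in the quotient thus becomes a condition on exponents.\<close>

lemma power_ideal_eq:
  "(power_ideal q n :: ((nat \<Rightarrow>\<^sub>0 nat) \<Rightarrow>\<^sub>0 'a::comm_ring_1) set) =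
     supported_on {t \<in> variables_below n. \<exists>j<n. q \<le> Poly_Mapping.lookup t j}"
    (is "_ = supported_on ?T")
proof
  interpret cring "mpoly_ring n :: ((nat \<Rightarrow>\<^sub>0 nat) \<Rightarrow>\<^sub>0 'a) ring" by (rule cring_mpoly_ring)
  let ?gens = "{mpoly_var j ^ q | j. j < n} :: ((nat \<Rightarrow>\<^sub>0 nat) \<Rightarrow>\<^sub>0 'a) set"
  have var_power: "(mpoly_var j :: (nat \<Rightarrow>\<^sub>0 nat) \<Rightarrow>\<^sub>0 'a) ^ k = mpoly_monom (Poly_Mapping.single j k)"
    for j k
    by (induction k)
      (simp_all add: mpoly_var_def mpoly_monom_def mult_single flip: single_add)
  have "ideal (supported_on ?T) (mpoly_ring n :: ((nat \<Rightarrow>\<^sub>0 nat) \<Rightarrow>\<^sub>0 'a) ring)"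
  proof (rule idealI)
    show "subgroup (supported_on ?T) (add_monoid (mpoly_ring n :: ((nat \<Rightarrow>\<^sub>0 nat) \<Rightarrow>\<^sub>0 'a) ring))"
      by (rule mpoly_ring_additive_subgroup) auto
    fix p r :: "(nat \<Rightarrow>\<^sub>0 nat) \<Rightarrow>\<^sub>0 'a"
    assume "p \<in> supported_on ?T" "r \<in> carrier (mpoly_ring n)"
    then show "p \<otimes>\<^bsub>mpoly_ring n\<^esub> r \<in> supported_on ?T"
      by (auto intro!: supported_on_mult[of p ?T r "variables_below n"] variables_below_add
          simp: lookup_add intro: trans_le_add1)
    then show "r \<otimes>\<^bsub>mpoly_ring n\<^esub> p \<in> supported_on ?T" by (simp add: mult.commute)
  qed (rule ring_axioms)
  then show "power_ideal q n \<subseteq> (supported_on ?T :: ((nat \<Rightarrow>\<^sub>0 nat) \<Rightarrow>\<^sub>0 'a) set)"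
    unfolding power_ideal_def
    by (rule genideal_minimal)
      (auto simp: var_power mpoly_monom_def variables_below_def split: if_splits intro!: supported_on_single)
  have gens_carrier: "?gens \<subseteq> carrier (mpoly_ring n)"
    by (auto simp: var_power mpoly_monom_def variables_below_def split: if_splits intro!: supported_on_single)
  interpret I: ideal "power_ideal q n" "mpoly_ring n :: ((nat \<Rightarrow>\<^sub>0 nat) \<Rightarrow>\<^sub>0 'a) ring"
    unfolding power_ideal_def by (rule genideal_ideal[OF gens_carrier])
  show "(supported_on ?T :: ((nat \<Rightarrow>\<^sub>0 nat) \<Rightarrow>\<^sub>0 'a) set) \<subseteq> power_ideal q n"
  proof
    fix p :: "(nat \<Rightarrow>\<^sub>0 nat) \<Rightarrow>\<^sub>0 'a" assume p: "p \<in> supported_on ?T"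
    have single: "Poly_Mapping.single t c \<in> power_ideal q n" if t: "t \<in> ?T" for t and c :: 'a
    proof -
      obtain j where j: "j < n" "q \<le> Poly_Mapping.lookup t j" using t by blast
      \<comment> \<open>The subtraction of exponents is truncated, but exact here as
        \<open>q\<close> is at most the exponent of variable \<open>j\<close>.\<close>
      define s where "s = t - Poly_Mapping.single j q"
      have "t = Poly_Mapping.single j q + s"
        using j by (auto intro!: poly_mapping_eqI simp: s_def lookup_add lookup_minus lookup_single when_def)
      then have "Poly_Mapping.single t c = mpoly_var j ^ q * Poly_Mapping.single s c"
        by (simp add: var_power mpoly_monom_def mult_single)
      moreover have "s \<in> variables_below n"
      proof -
        have "Poly_Mapping.keys s \<subseteq> Poly_Mapping.keys t"
          by (auto simp: s_def in_keys_iff lookup_minus)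
        then show ?thesis using t by (auto simp: variables_below_def)
      qed
      moreover have "(mpoly_var j ^ q :: (nat \<Rightarrow>\<^sub>0 nat) \<Rightarrow>\<^sub>0 'a) \<in> power_ideal q n"
        unfolding power_ideal_def using genideal_self[OF gens_carrier] j by blast
      ultimately show ?thesis
        using I.I_r_closed[of "mpoly_var j ^ q" "Poly_Mapping.single s c"]
        by (simp add: supported_on_single)
    qed
    have "(\<Sum>t\<in>K. Poly_Mapping.single t (Poly_Mapping.lookup p t)) \<in> power_ideal q n"
      if "finite K" "K \<subseteq> ?T" for K
      using that
    proof (induction K)
      case empty
      then show ?case using I.zero_closed by simp
    next
      case (insert t K)
      then show ?case using I.a_closed[OF single, of t] by simp
    qed
    from this[of "Poly_Mapping.keys p"] p show "p \<in> power_ideal q n"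
      by (simp add: sum_single_keys supported_on_def)
  qed
qed

text \<open>Exponents of \<open>q\<close> or more are permitted; such monomials become zero only in
  the quotient. Level 0 has all monomials of the algebra, and level 1 omits just the constant
  one.\<close>

definition admissible_monomials :: "nat \<Rightarrow> nat \<Rightarrow> nat \<Rightarrow> nat \<Rightarrow> (nat \<Rightarrow>\<^sub>0 nat) set" where
  "admissible_monomials q n e k =
     {t \<in> variables_below n. e dvd monomial_weight q n t \<and> k \<le> monomial_degree n t}"

lemma admissible_monomials_add:
  "s \<in> admissible_monomials q n e k \<Longrightarrow> t \<in> admissible_monomials q n e l \<Longrightarrow>
     s + t \<in> admissible_monomials q n e (k + l)"
  by (auto simp: admissible_monomials_def monomial_weight_add monomial_degree_add
      intro: variables_below_add)

lemma admissible_monomials_zero: "0 \<in> admissible_monomials q n e 0"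
  by (simp add: admissible_monomials_def monomial_weight_def)

section \<open>The algebra and its degree filtration\<close>

locale truncated_monomial_algebra =
  fixes F :: "'a::field itself" and q n e :: nat
  assumes q_pos: "0 < q"
begin

definition P :: "((nat \<Rightarrow>\<^sub>0 nat) \<Rightarrow>\<^sub>0 'a) ring" where "P = mpoly_ring n"

definition Q :: "((nat \<Rightarrow>\<^sub>0 nat) \<Rightarrow>\<^sub>0 'a) set ring" where "Q = truncated_mpoly_ring q n"

definition proj :: "((nat \<Rightarrow>\<^sub>0 nat) \<Rightarrow>\<^sub>0 'a) \<Rightarrow> ((nat \<Rightarrow>\<^sub>0 nat) \<Rightarrow>\<^sub>0 'a) set" where
  "proj = truncated_class q n"

definition A :: "((nat \<Rightarrow>\<^sub>0 nat) \<Rightarrow>\<^sub>0 'a) set ring" where "A = algebra_A F q n e"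

definition polys :: "nat \<Rightarrow> ((nat \<Rightarrow>\<^sub>0 nat) \<Rightarrow>\<^sub>0 'a) set" where
  "polys k = supported_on (admissible_monomials q n e k)"

text \<open>The intersection builds membership in the algebra into the definition, so that level 0
  is the full carrier by \<open>carrier_A_subset\<close> alone.\<close>

definition filtration :: "nat \<Rightarrow> ((nat \<Rightarrow>\<^sub>0 nat) \<Rightarrow>\<^sub>0 'a) set set" where
  "filtration k = proj ` polys k \<inter> carrier A"

sublocale P: cring P
  unfolding P_def by (rule cring_mpoly_ring)

lemma P_simps [simp]:
  "carrier P = supported_on (variables_below n)"
  "x \<otimes>\<^bsub>P\<^esub> y = x * y" "\<one>\<^bsub>P\<^esub> = 1" "x \<oplus>\<^bsub>P\<^esub> y = x + y" "\<zero>\<^bsub>P\<^esub> = 0"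
  by (simp_all add: P_def)

lemma ideal_power_ideal: "ideal (power_ideal q n) P"
  unfolding power_ideal_def P_def[symmetric]
proof (rule P.genideal_ideal)
  have "mpoly_var j ^ q \<in> carrier P" if "j < n" for j
  proof -
    have "mpoly_var j \<in> carrier P"
      using that by (auto simp: mpoly_var_def mpoly_monom_def variables_below_def intro!: supported_on_single)
    then show ?thesis
      by (induction q) (auto intro: one_supported_on mpoly_ring_mult_closed)
  qed
  then show "{mpoly_var j ^ q |j. j < n} \<subseteq> carrier P" by blast
qed

sublocale proj: ring_hom_cring P Q proj
  using ideal.rcos_ring_hom_cring[OF ideal_power_ideal P.cring_axioms]
  by (simp add: Q_def proj_def truncated_mpoly_ring_def truncated_class_def[abs_def] P_def)

lemma proj_eq_zero_iff:
  assumes "p \<in> carrier P"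
  shows "proj p = \<zero>\<^bsub>Q\<^esub> \<longleftrightarrow>
    (\<forall>t\<in>Poly_Mapping.keys p. \<exists>j<n. q \<le> Poly_Mapping.lookup t j)"
proof -
  have "proj p = \<zero>\<^bsub>Q\<^esub> \<longleftrightarrow> p \<in> power_ideal q n"
  proof -
    have "\<zero>\<^bsub>Q\<^esub> = power_ideal q n"
      by (simp add: Q_def truncated_mpoly_ring_def FactRing_def)
    moreover have "proj p = power_ideal q n +>\<^bsub>P\<^esub> p"
      by (simp add: proj_def truncated_class_def P_def)
    ultimately show ?thesis
      using assms ideal.rcos_const_imp_mem[OF ideal_power_ideal] P.a_rcos_zero[OF ideal_power_ideal]
      by metis
  qed
  also have "\<dots> \<longleftrightarrow> (\<forall>t\<in>Poly_Mapping.keys p. \<exists>j<n. q \<le> Poly_Mapping.lookup t j)"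
    using assms by (auto simp: power_ideal_eq supported_on_def)
  finally show ?thesis .
qed

lemma polys_subset: "polys k \<subseteq> carrier P"
  unfolding polys_def P_simps by (rule supported_on_mono) (auto simp: admissible_monomials_def)

lemma polys_mult: "p \<in> polys k \<Longrightarrow> r \<in> polys l \<Longrightarrow> p * r \<in> polys (k + l)"
  unfolding polys_def by (erule supported_on_mult) (auto intro: admissible_monomials_add)

lemma polys_subgroup: "subgroup (polys k) (add_monoid P)"
  unfolding polys_def P_def
  by (rule mpoly_ring_additive_subgroup) (auto simp: admissible_monomials_def)

lemma const_in_polys: "mpoly_const c \<in> polys 0"
  by (simp add: polys_def mpoly_const_def supported_on_single admissible_monomials_zero)

lemma polys_subring: "subring (polys 0) P"
proof (rule subring.intro)
  show "submonoid (polys 0) P"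
    by (rule submonoid.intro)
      (use polys_subset polys_mult[of _ 0 _ 0] const_in_polys[of 1] in \<open>auto simp: mpoly_const_def\<close>)
qed (rule polys_subgroup)

lemma carrier_A:
  "carrier A = generated_subalgebra (range (\<lambda>c. proj (mpoly_const c))) Q
     {proj (mpoly_monom t) | t. t \<in> admissible_monomials q n e 0}"
  by (simp add: A_def algebra_A_def proj_def Q_def admissible_monomials_def variables_below_def
      monomial_weight_def)

lemma A_eq: "A = Q\<lparr>carrier := carrier A\<rparr>"
  by (simp add: A_def algebra_A_def Q_def)

lemma A_simps [simp]:
  "x \<otimes>\<^bsub>A\<^esub> y = x \<otimes>\<^bsub>Q\<^esub> y" "\<one>\<^bsub>A\<^esub> = \<one>\<^bsub>Q\<^esub>" "x \<oplus>\<^bsub>A\<^esub> y = x \<oplus>\<^bsub>Q\<^esub> y" "\<zero>\<^bsub>A\<^esub> = \<zero>\<^bsub>Q\<^esub>"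
  by (subst A_eq, simp)+

text \<open>The image of \<open>polys 0\<close> is itself one of the subalgebras over which the
  intersection is taken.\<close>

lemma carrier_A_subset: "carrier A \<subseteq> proj ` polys 0"
proof -
  have "subring (proj ` polys 0) Q"
    using polys_subring by (rule proj.ring.img_is_subring)
  moreover have "subalgebra (range (\<lambda>c. proj (mpoly_const c))) (proj ` polys 0) Q"
  proof (intro subalgebra.intro subalgebra_axioms.intro)
    show "subgroup (proj ` polys 0) (add_monoid Q)"
      using polys_subgroup by (rule proj.ring.img_is_add_subgroup)
    fix a b assume "a \<in> range (\<lambda>c. proj (mpoly_const c))" "b \<in> proj ` polys 0"
    then show "a \<otimes>\<^bsub>Q\<^esub> b \<in> proj ` polys 0"
      using subringE(6)[OF \<open>subring (proj ` polys 0) Q\<close>] const_in_polys by blast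
  qed
  moreover have "{proj (mpoly_monom t) | t. t \<in> admissible_monomials q n e 0} \<subseteq> proj ` polys 0"
    by (auto simp: polys_def mpoly_monom_def intro!: imageI supported_on_single)
  ultimately show ?thesis
    unfolding carrier_A generated_subalgebra_def by blast
qed

lemma carrier_A_subring: "subring (carrier A) Q"
proof -
  have "subalgebra K (carrier Q) Q" if "K \<subseteq> carrier Q" for K
    using that proj.S.add.subgroup_self
    by (intro subalgebra.intro subalgebra_axioms.intro) auto
  show ?thesis
    unfolding carrier_A generated_subalgebra_def
  proof (rule proj.S.subring_Inter)
    have "range (\<lambda>c. proj (mpoly_const c)) \<subseteq> carrier Q"
      using const_in_polys polys_subset by (blast intro: proj.hom_closed)
    moreover have "{proj (mpoly_monom t) | t. t \<in> admissible_monomials q n e 0} \<subseteq> carrier Q"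
      by (auto simp: mpoly_monom_def admissible_monomials_def intro!: proj.hom_closed supported_on_single)
    \<comment> \<open>An intersection of subrings is a subring only for a nonempty family; the whole
      ring \<open>Q\<close> is a member.\<close>
    ultimately show "{V. subring V Q \<and> subalgebra (range (\<lambda>c. proj (mpoly_const c))) V Q \<and>
        {proj (mpoly_monom t) |t. t \<in> admissible_monomials q n e 0} \<subseteq> V} \<noteq> {}"
      using proj.S.carrier_is_subring \<open>\<And>K. K \<subseteq> carrier Q \<Longrightarrow> subalgebra K (carrier Q) Q\<close> by blast
  qed blast
qed

sublocale A: cring A
  using proj.S.subcring_iff[OF subringE(1)[OF carrier_A_subring]]
    proj.S.subcringI'[OF carrier_A_subring] A_eq by simp

lemma const_in_A: "proj (mpoly_const c) \<in> carrier A"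
proof -
  have "proj (mpoly_const c) \<in> V"
    if "subring V Q" "subalgebra (range (\<lambda>c. proj (mpoly_const c))) V Q" for V
  proof -
    \<comment> \<open>Constants enter a subalgebra as scalar multiples of its unit.\<close>
    have "proj (mpoly_const c) \<otimes>\<^bsub>Q\<^esub> \<one>\<^bsub>Q\<^esub> \<in> V"
      using that subringE(3) by (intro subalgebra.smult_closed[OF that(2)]) auto
    moreover have "proj (mpoly_const c) \<in> carrier Q"
      using const_in_polys polys_subset by (intro proj.hom_closed) blast
    ultimately show ?thesis by simp
  qed
  then show ?thesis unfolding carrier_A generated_subalgebra_def by blast
qed

lemma monom_in_A:
  "t \<in> admissible_monomials q n e 0 \<Longrightarrow> proj (mpoly_monom t) \<in> carrier A"
  unfolding carrier_A generated_subalgebra_def by blast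

lemma filtration_mult:
  assumes "x \<in> filtration k" and "y \<in> filtration l"
  shows "x \<otimes>\<^bsub>A\<^esub> y \<in> filtration (k + l)"
proof -
  obtain p r where "x = proj p" "p \<in> polys k" "y = proj r" "r \<in> polys l"
    using assms by (auto simp: filtration_def)
  then have "x \<otimes>\<^bsub>A\<^esub> y = proj (p * r)" "p * r \<in> polys (k + l)"
    using polys_subset polys_mult proj.hom_mult[of p r] by auto
  moreover have "x \<otimes>\<^bsub>A\<^esub> y \<in> carrier A"
    using assms by (intro A.m_closed) (auto simp: filtration_def)
  ultimately show ?thesis by (auto simp: filtration_def)
qed

lemma filtration_0: "filtration 0 = carrier A"
  using carrier_A_subset by (auto simp: filtration_def)

lemma filtration_ideal: "ideal (filtration k) A"
proof (rule idealI)
  have A_subgroup: "subgroup (carrier A) (add_monoid Q)"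
    using carrier_A_subring by (rule subring.axioms(1))
  have "subgroup (filtration k) (add_monoid Q)"
    unfolding filtration_def using A_subgroup
    by (intro proj.S.add.subgroups_Inter_pair proj.ring.img_is_add_subgroup polys_subgroup)
  then have "subgroup (filtration k) ((add_monoid Q)\<lparr>carrier := carrier A\<rparr>)"
    using A_subgroup by (rule proj.S.add.subgroup_incl) (simp add: filtration_def)
  then show "subgroup (filtration k) (add_monoid A)"
    by (subst A_eq) simp
next
  fix x y assume "x \<in> filtration k" "y \<in> carrier A"
  then show "y \<otimes>\<^bsub>A\<^esub> x \<in> filtration k" "x \<otimes>\<^bsub>A\<^esub> y \<in> filtration k"
    using filtration_mult[of x k y 0] filtration_mult[of y 0 x k] by (simp_all add: filtration_0)
qed (rule A.ring_axioms)

text \<open>The gap behind the factor \<open>m\<close>: a nonconstant admissible monomial has degree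
  at least the minimal length, so the levels in between coincide.\<close>

lemma filtration_1: "filtration 1 = filtration (min_power_sum_length q e)"
  (is "_ = filtration ?m") if "0 < e"
proof -
  have "admissible_monomials q n e 1 = admissible_monomials q n e ?m"
    using min_power_sum_length_le_degree min_power_sum_length_witness(1)[OF that, of q]
    by (fastforce simp: admissible_monomials_def)
  then show ?thesis by (simp add: filtration_def polys_def)
qed

text \<open>In degree above \<open>n * (q - 1)\<close> some exponent must reach \<open>q\<close>, by
  the pigeonhole principle.\<close>

lemma filtration_eq_zero:
  assumes "n * (q - 1) < k"
  shows "filtration k = {\<zero>\<^bsub>A\<^esub>}"
proof
  show "{\<zero>\<^bsub>A\<^esub>} \<subseteq> filtration k"
    using additive_subgroup.zero_closed[OF ideal.axioms(1)[OF filtration_ideal]] by simp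
  show "filtration k \<subseteq> {\<zero>\<^bsub>A\<^esub>}"
  proof
    fix x assume "x \<in> filtration k"
    then obtain p where p: "x = proj p" "p \<in> polys k" by (auto simp: filtration_def)
    have "\<exists>j<n. q \<le> Poly_Mapping.lookup t j" if "t \<in> Poly_Mapping.keys p" for t
    proof (rule ccontr)
      assume "\<not> ?thesis"
      then have "Poly_Mapping.lookup t j \<le> q - 1" if "j < n" for j
        using that by (metis Suc_leI Suc_pred' diff_Suc_1 leI less_Suc_eq_le q_pos)
      then have "monomial_degree n t \<le> (\<Sum>j<n. q - 1)"
        unfolding monomial_degree_def by (intro sum_mono) auto
      moreover have "k \<le> monomial_degree n t"
        using p that by (auto simp: polys_def supported_on_def admissible_monomials_def)
      ultimately show False using assms by simp
    qed
    then show "x \<in> {\<zero>\<^bsub>A\<^esub>}"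
      using p polys_subset[of k] proj_eq_zero_iff[of p] by auto
  qed
qed

text \<open>Level 1 consists of the elements represented without constant term. It is nilpotent for
  degree reasons, and an element outside it becomes 1 plus an element of level 1 after division by
  its constant term.\<close>

lemma jacobson_radical_A: "jacobson_radical A = filtration 1"
proof (rule A.jacobson_radical_eq_nil_maximal_ideal)
  show "ideal (filtration 1) A" by (rule filtration_ideal)
  have no_const: "Poly_Mapping.lookup p 0 = 0" if "p \<in> polys 1" for p
    using that by (force simp: polys_def supported_on_def admissible_monomials_def
        monomial_degree_def in_keys_iff)
  show "\<one>\<^bsub>A\<^esub> \<notin> filtration 1"
  proof
    assume "\<one>\<^bsub>A\<^esub> \<in> filtration 1"
    then obtain p where p: "proj 1 = proj p" "p \<in> polys 1"
      using proj.hom_one by (auto simp: filtration_def)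
    then have p_carrier: "p \<in> carrier P" "1 \<in> carrier P" using polys_subset P.one_closed by auto
    then have minus: "1 + (- p) = 1 \<ominus>\<^bsub>P\<^esub> p"
      by (simp add: P_def a_minus_def mpoly_ring_uminus)
    have "proj (1 + (- p)) = \<zero>\<^bsub>Q\<^esub>"
      unfolding minus using p p_carrier by (simp add: a_minus_def proj.S.r_neg del: P_simps)
    moreover have "1 + (- p) \<in> carrier P" using minus P.minus_closed p_carrier by metis
    \<comment> \<open>The constant term of \<open>1 - p\<close> is 1, and as \<open>q\<close> is
      positive, the constant monomial survives truncation.\<close>
    moreover have "0 \<in> Poly_Mapping.keys (1 + (- p))"
      using no_const[OF p(2)] by (simp add: in_keys_iff lookup_minus lookup_one)
    ultimately show False using proj_eq_zero_iff q_pos by fastforce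
  qed
  fix x
  {
    assume x: "x \<in> filtration 1"
    have "x [^]\<^bsub>A\<^esub> k \<in> filtration k" for k :: nat
    proof (induction k)
      case 0
      then show ?case using A.one_closed by (simp add: filtration_0 del: A_simps)
    next
      case (Suc k)
      then show ?case using filtration_mult[OF _ x, of _ k] by (simp del: A_simps)
    qed
    from this[of "Suc (n * (q - 1))"] show "\<exists>k::nat. x [^]\<^bsub>A\<^esub> k = \<zero>\<^bsub>A\<^esub>"
      using filtration_eq_zero[OF lessI] by blast
  }
  assume x: "x \<in> carrier A" "x \<notin> filtration 1"
  then obtain p where p: "x = proj p" "p \<in> polys 0" using carrier_A_subset by blast
  define c where "c = Poly_Mapping.lookup p 0"
  define r where "r = p - mpoly_const c"
  have p_eq: "p = mpoly_const c + r" by (simp add: r_def)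
  have r: "r \<in> polys 1"
    unfolding polys_def supported_on_def
  proof (intro CollectI subsetI)
    fix t assume t: "t \<in> Poly_Mapping.keys r"
    then have "t \<noteq> 0"
      by (auto simp: in_keys_iff r_def c_def mpoly_const_def lookup_minus)
    then have "t \<in> Poly_Mapping.keys p"
      using t by (auto simp: in_keys_iff r_def mpoly_const_def lookup_minus lookup_single)
    then show "t \<in> admissible_monomials q n e 1"
      using p(2) \<open>t \<noteq> 0\<close> monomial_degree_eq_0_iff[of t n]
      by (auto simp: polys_def supported_on_def admissible_monomials_def variables_below_def Suc_le_eq)
  qed
  \<comment> \<open>Otherwise \<open>p = r\<close> would put \<open>x\<close> into level 1.\<close>
  have "c \<noteq> 0"
    using x p r p_eq by (auto simp: filtration_def mpoly_const_def)
  define y where "y = mpoly_const (1 / c)"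
  have y: "y \<in> polys 0" by (simp add: y_def const_in_polys)
  have ry: "r * y \<in> polys 1" using polys_mult[OF r y] by simp
  have "p * y = 1 + r * y"
    using \<open>c \<noteq> 0\<close> by (simp add: p_eq y_def mpoly_const_def distrib_right mult_single)
  then have "proj (p * y) = proj (1 + r * y)" by simp
  moreover have carriers: "p \<in> carrier P" "y \<in> carrier P" "r \<in> carrier P" "1 \<in> carrier P"
      "r * y \<in> carrier P"
    using p y r ry polys_subset P.one_closed by auto
  ultimately have eq: "x \<otimes>\<^bsub>A\<^esub> proj y = \<one>\<^bsub>A\<^esub> \<oplus>\<^bsub>A\<^esub> proj (r * y)"
    using p(1) proj.hom_mult[of p y] proj.hom_add[of 1 "r * y"] proj.hom_one by simp
  have y_A: "proj y \<in> carrier A" by (simp add: y_def const_in_A)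
  \<comment> \<open>Membership in level 1 also requires membership in the algebra, which is seen by
    solving the equation for this element: it is \<open>x\<close> times \<open>proj y\<close> minus
    the unit.\<close>
  have "proj (r * y) = \<ominus>\<^bsub>A\<^esub> \<one>\<^bsub>A\<^esub> \<oplus>\<^bsub>A\<^esub> x \<otimes>\<^bsub>A\<^esub> proj y"
  proof -
    have "proj (r * y) \<in> carrier Q" using carriers by blast
    then have "proj (r * y) = \<ominus>\<^bsub>Q\<^esub> \<one>\<^bsub>Q\<^esub> \<oplus>\<^bsub>Q\<^esub> x \<otimes>\<^bsub>Q\<^esub> proj y"
      using eq by (simp add: proj.S.r_neg1)
    moreover have "\<ominus>\<^bsub>A\<^esub> \<one>\<^bsub>A\<^esub> = \<ominus>\<^bsub>Q\<^esub> \<one>\<^bsub>Q\<^esub>"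
    proof (rule proj.S.minus_equality[symmetric])
      have "\<ominus>\<^bsub>A\<^esub> \<one>\<^bsub>A\<^esub> \<in> carrier A" by blast
      then show "\<ominus>\<^bsub>A\<^esub> \<one>\<^bsub>A\<^esub> \<in> carrier Q" using subringE(1)[OF carrier_A_subring] by blast
      show "\<ominus>\<^bsub>A\<^esub> \<one>\<^bsub>A\<^esub> \<oplus>\<^bsub>Q\<^esub> \<one>\<^bsub>Q\<^esub> = \<zero>\<^bsub>Q\<^esub>"
        using A.l_neg[OF A.one_closed] by simp
    qed simp
    ultimately show ?thesis by simp
  qed
  then have "proj (r * y) \<in> carrier A"
    using x y_A by (metis A.a_closed A.a_inv_closed A.m_closed A.one_closed)
  with ry have "proj (r * y) \<in> filtration 1" by (simp add: filtration_def)
  with eq y_A show "\<exists>y\<in>carrier A. \<exists>z\<in>filtration 1. x \<otimes>\<^bsub>A\<^esub> y = \<one>\<^bsub>A\<^esub> \<oplus>\<^bsub>A\<^esub> z" by blast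
qed

section \<open>Powers of the radical and the Loewy length\<close>

definition radical_power :: "nat \<Rightarrow> ((nat \<Rightarrow>\<^sub>0 nat) \<Rightarrow>\<^sub>0 'a) set set" where
  "radical_power l = jacobson_radical A [^]\<^bsub>ideals_set A\<^esub> l"

lemma radical_power_0: "radical_power 0 = carrier A"
  by (simp add: radical_power_def nat_pow_def ideals_set_def)

lemma radical_power_Suc:
  "radical_power (Suc l) = ideal_prod A (radical_power l) (jacobson_radical A)"
  by (simp add: radical_power_def nat_pow_def ideals_set_def)

lemma radical_power_ideal: "ideal (radical_power l) A"
  by (induction l)
    (auto simp: radical_power_0 radical_power_Suc jacobson_radical_A
      intro: A.oneideal A.ideal_prod_is_ideal filtration_ideal)

text \<open>By \<open>filtration_1\<close> every factor from the radical raises the level by the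
  full minimal length.\<close>

lemma radical_power_subset:
  assumes "0 < e"
  shows "radical_power l \<subseteq> filtration (l * min_power_sum_length q e)"
proof (induction l)
  case 0
  then show ?case by (simp add: radical_power_0 filtration_0)
next
  case (Suc l)
  let ?m = "min_power_sum_length q e"
  have "x \<in> filtration (Suc l * ?m)"
    if "x \<in> ideal_prod A (radical_power l) (jacobson_radical A)" for x
    using that
  proof induction
    case (prod i j)
    then show ?case
      using filtration_mult[of i "l * ?m" j ?m] Suc filtration_1[OF assms]
      by (auto simp: jacobson_radical_A add.commute)
  next
    case (sum x y)
    then show ?case
      using additive_subgroup.a_closed[OF ideal.axioms(1)[OF filtration_ideal]] by blast
  qed
  then show ?case by (auto simp: radical_power_Suc)
qed

text \<open>Supplies elements of high radical powers for the lower bound: adding exponent vectors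
  multiplies the classes, and each nonconstant factor lies in the radical.\<close>

lemma monomial_product_in_radical_power:
  assumes "finite S"
    and "\<And>s. s \<in> S \<Longrightarrow> v s \<in> admissible_monomials q n e 1"
  shows "proj (mpoly_monom (\<Sum>s\<in>S. v s)) \<in> radical_power (card S)"
  using assms
proof (induction S rule: finite_induct)
  case empty
  then show ?case
    using const_in_A[of 1] by (simp add: radical_power_0 mpoly_monom_def mpoly_const_def)
next
  case (insert s S)
  have sum: "(\<Sum>s\<in>S. v s) \<in> variables_below n"
    using insert by (intro variables_below_sum) (auto simp: admissible_monomials_def)
  have s: "v s \<in> admissible_monomials q n e 1" using insert by auto
  then have s0: "v s \<in> admissible_monomials q n e 0" by (simp add: admissible_monomials_def)
  have "proj (mpoly_monom (v s)) \<in> jacobson_radical A"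
    using s monom_in_A[OF s0]
    by (auto simp: jacobson_radical_A filtration_def polys_def mpoly_monom_def intro!: supported_on_single)
  then have "proj (mpoly_monom (\<Sum>s\<in>S. v s)) \<otimes>\<^bsub>A\<^esub> proj (mpoly_monom (v s)) \<in> radical_power (Suc (card S))"
    unfolding radical_power_Suc using insert by (intro ideal_prod.prod) auto
  moreover have "proj (mpoly_monom (\<Sum>s\<in>S. v s)) \<otimes>\<^bsub>A\<^esub> proj (mpoly_monom (v s)) =
      proj (mpoly_monom (\<Sum>s\<in>S. v s) * mpoly_monom (v s))"
    using sum s by (simp add: mpoly_monom_def admissible_monomials_def supported_on_single
        proj.hom_mult[simplified])
  moreover have "mpoly_monom (\<Sum>s\<in>S. v s) * mpoly_monom (v s) = (mpoly_monom (\<Sum>s\<in>insert s S. v s) :: _ \<Rightarrow>\<^sub>0 'a)"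
    using insert by (simp add: mpoly_monom_def mult_single add.commute)
  ultimately show ?case using insert by simp
qed

lemma radical_power_decseq: "radical_power (l + k) \<subseteq> radical_power l"
proof (induction k)
  case (Suc k)
  have "radical_power (Suc (l + k)) \<subseteq> radical_power (l + k)"
    unfolding radical_power_Suc
    using A.ideal_prod_inter[OF radical_power_ideal] filtration_ideal jacobson_radical_A by auto
  with Suc show ?case by simp
qed simp

text \<open>The power \<open>N + 1\<close> of the radical sits in a level above
  \<open>n * (q - 1)\<close> and vanishes. The product over the packing lies in the power
  \<open>N\<close> and is nonzero, as all its exponents are below \<open>q\<close>.\<close>

lemma loewy_length_A:
  assumes "0 < e" and "admissible_packing q n e N"
    and "N * min_power_sum_length q e = n * (q - 1)"
  shows "loewy_length A = N + 1"
  unfolding loewy_length_def radical_power_def[symmetric]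
proof (rule Least_equality)
  let ?m = "min_power_sum_length q e"
  have "n * (q - 1) < (N + 1) * ?m"
    using assms min_power_sum_length_witness(1)[OF \<open>0 < e\<close>, of q] by simp
  then have "radical_power (N + 1) \<subseteq> {\<zero>\<^bsub>A\<^esub>}"
    using radical_power_subset[OF \<open>0 < e\<close>] filtration_eq_zero by blast
  then show "radical_power (N + 1) = {\<zero>\<^bsub>A\<^esub>}"
    using additive_subgroup.zero_closed[OF ideal.axioms(1)[OF radical_power_ideal]] by blast
next
  fix l assume l: "radical_power l = {\<zero>\<^bsub>A\<^esub>}"
  show "N + 1 \<le> l"
  proof (rule ccontr)
    assume "\<not> N + 1 \<le> l"
    \<comment> \<open>The powers decrease, so vanishing at some \<open>l <= N\<close> would force
      the power \<open>N\<close> to vanish.\<close>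
    then have "radical_power N \<subseteq> radical_power l"
      using radical_power_decseq[of l "N - l"] by simp
    moreover obtain S :: "(nat \<times> nat \<times> nat) set" and v where S: "finite S" "card S = N"
      and v: "\<And>s. s \<in> S \<Longrightarrow> v s \<noteq> 0 \<and> Poly_Mapping.keys (v s) \<subseteq> {..<n} \<and> e dvd monomial_weight q n (v s)"
      and small: "\<And>j. Poly_Mapping.lookup (\<Sum>s\<in>S. v s) j < q"
      using assms(2) unfolding admissible_packing_def by blast
    have "v s \<in> admissible_monomials q n e 1" if "s \<in> S" for s
      using v[OF that] monomial_degree_eq_0_iff[of "v s" n]
      by (simp add: admissible_monomials_def variables_below_def Suc_le_eq)
    then have "proj (mpoly_monom (\<Sum>s\<in>S. v s)) \<in> radical_power N"
      using monomial_product_in_radical_power[OF S(1), of v] S(2) by simp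
    ultimately have "proj (mpoly_monom (\<Sum>s\<in>S. v s)) = \<zero>\<^bsub>Q\<^esub>" using l by auto
    moreover have "(\<Sum>s\<in>S. v s) \<in> variables_below n"
      using v by (intro variables_below_sum) (simp add: variables_below_def)
    ultimately have "\<exists>j<n. q \<le> Poly_Mapping.lookup (\<Sum>s\<in>S. v s) j"
      using proj_eq_zero_iff[of "mpoly_monom (\<Sum>s\<in>S. v s)"]
      by (simp add: mpoly_monom_def supported_on_single)
    with small show False by (meson leD)
  qed
qed

end

theorem mainTheorem3:
  fixes q n e :: nat
  assumes "0 < n" and "0 < e" and "1 < q"
    and "e dvd q ^ n - 1"
    and "\<exists>d. (d \<in> {6, 9, 10} \<or> (\<exists>a. d = 2 ^ a)) \<and>
           (\<exists>k::int. poly (cyclotomic_poly d) (of_nat q) = of_int (int e * k))"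
  shows "int (loewy_length (algebra_A TYPE('a::field) q n e)) =
           \<lfloor>real n * ((real q - 1) / real (min_power_sum_length q e))\<rfloor> + 1"
proof -
  have "0 < q" using \<open>1 < q\<close> by simp
  interpret truncated_monomial_algebra "TYPE('a)" q n e
    by unfold_locales fact
  define m where "m = min_power_sum_length q e"
  have "0 < m" using min_power_sum_length_witness(1)[OF \<open>0 < e\<close>] by (simp add: m_def)
  have "e dvd q - 1 \<or> (\<exists>h. e dvd q ^ h + 1) \<or> e dvd q ^ 6 + q ^ 3 + 1"
    using assms(5) dvd_cyclotomic_value_cases \<open>0 < q\<close> by blast
  then obtain N where N: "admissible_packing q n e N" "N * m = n * (q - 1)"
    using optimal_packing[OF assms(1,2) \<open>0 < q\<close> assms(4)] unfolding m_def by blast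
  have "loewy_length (algebra_A TYPE('a) q n e) = N + 1"
    using loewy_length_A[OF \<open>0 < e\<close>] N unfolding A_def m_def by blast
  \<comment> \<open>The quotient under the floor is the integer \<open>N\<close>, so nothing is lost
    by rounding.\<close>
  moreover have "real n * ((real q - 1) / real m) = real N"
  proof -
    have "real N * real m = real n * (real q - 1)"
      using arg_cong[OF N(2), of real] \<open>0 < q\<close> by (simp add: of_nat_diff)
    then show ?thesis using \<open>0 < m\<close> by (simp add: field_simps)
  qed
  ultimately show ?thesis by (simp add: m_def)
qed

end
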